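(* Let $p$ be a prime and let $r, s$ be integers with $p \nmid r$. Let $$S(p,r,s) = \{ j \in \{0,1,\ldots,p-1\} : j - s \equiv \tfrac12 r n(3n-1) \pmod p \text{ for some integer } n\}.$$ If $j \in \{1,2,\ldots,p-1-\max S(p,r,s)\}$, then $$\xi_{r,s}(p^{\lambda} m - j) \equiv 0 \pmod{p^{\lambda}}$$ for all positive integers $m$ and $\lambda$. Moreover, if $p \geq 5$ and $$\operatorname{digit}_1(s - r/24; p) \neq p-1,$$ then the same conclusion holds for all $j \in \{1,2,\ldots,p-1-\max S^{\ast}(p,r,s)\}$, where $S^{\ast}(p,r,s) = S(p,r,s) \setminus \{i_0\}$ and $i_0 \in \{0,1,\ldots,p-1\}$ is such that $i_0 - s \equiv -r/24 \pmod p$.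
   Context: For integers $r, s$, the numbers $\xi_{r,s}(n)$, $n \geq 0$, are defined by the identity of formal power series in $q$ $$\sum_{n \geq 0} \xi_{r,s}(n) q^n = (1-q)^s \sum_{n \geq 0} \prod_{j=1}^n \bigl(1 - (1-q)^{rj}\bigr),$$ where $(1-q)^k$ for negative $k$ is the usual power series expansion; the sum is well defined since the $n$-th summand is divisible by $q^n$. For $p \geq 5$ prime, the rational number $s - r/24$ is a $p$-adic integer and has a unique $p$-adic expansion $\sum_{k\geq 0} n_k p^k$ with $n_k \in \{0,1,\ldots,p-1\}$; $\operatorname{digit}_1(s-r/24;p)$ denotes the digit $n_1$. Also $-r/24$ modulo $p$ means the residue $x$ with $24x \equiv -r \pmod p$. *)

theory Defs
  imports "HOL-Computational_Algebra.Computational_Algebra" "HOL-Number_Theory.Cong"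
begin

text \<open>The power of \<open>1 - q\<close> with an integer exponent, as a power series with integer coefficients.
  The ring of integers has no inverse operation, so negative powers use the geometric series.\<close>

definition one_minus_q_powi :: "int \<Rightarrow> int fps" where
  "one_minus_q_powi k =
     (if k \<ge> 0 then (1 - fps_X) ^ nat k else Abs_fps (\<lambda>_. 1) ^ nat (- k))"

lemma one_minus_q_mult_geometric: "(1 - fps_X) * Abs_fps (\<lambda>_. 1) = (1 :: int fps)"
  by (rule fps_ext) (auto simp: left_diff_distrib fps_X_mult_nth)

lemma one_minus_q_powi_inverse: "one_minus_q_powi k * one_minus_q_powi (- k) = 1"
proof -
  have "(1 - fps_X) ^ n * Abs_fps (\<lambda>_. 1) ^ n = (1 :: int fps)" for n
    by (simp add: one_minus_q_mult_geometric flip: power_mult_distrib)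
  then show ?thesis
    by (auto simp: one_minus_q_powi_def mult.commute)
qed

definition fishburn_term :: "int \<Rightarrow> nat \<Rightarrow> int fps" where
  "fishburn_term r n = (\<Prod>j = 1..n. (1 - one_minus_q_powi (r * int j)))"

text \<open>The infinite sum is taken in the usual topology of formal power series.\<close>

definition xi :: "int \<Rightarrow> int \<Rightarrow> nat \<Rightarrow> int" where
  "xi r s n = fps_nth (one_minus_q_powi s * (\<Sum>n. fishburn_term r n)) n"

lemma one_minus_q_powi_nth_0 [simp]: "fps_nth (one_minus_q_powi k) 0 = 1"
  by (simp add: one_minus_q_powi_def fps_nth_power_0)

lemma fishburn_term_nth_eq_0:
  assumes "k < n"
  shows "fps_nth (fishburn_term r n) k = 0"
proof -
  have "fps_X dvd (1 - one_minus_q_powi (r * int j))" for j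
  proof -
    have "1 - one_minus_q_powi (r * int j) = fps_X * fps_shift 1 (1 - one_minus_q_powi (r * int j))"
      by (rule fps_ext) (auto simp: fps_X_mult_nth)
    then show ?thesis by (rule dvdI)
  qed
  then have "(\<Prod>j = 1..n. fps_X) dvd fishburn_term r n"
    unfolding fishburn_term_def by (intro prod_dvd_prod) blast
  then obtain g where "fishburn_term r n = fps_X ^ n * g"
    by (auto simp: dvd_def)
  with assms show ?thesis
    by (simp add: fps_X_power_mult_nth)
qed

lemma fishburn_term_sums:
  "fishburn_term r sums Abs_fps (\<lambda>k. \<Sum>n\<le>k. fps_nth (fishburn_term r n) k)"
  unfolding sums_def
proof (rule tendsto_fpsI)
  fix k
  have "fps_nth (\<Sum>n<N. fishburn_term r n) k = (\<Sum>n\<le>k. fps_nth (fishburn_term r n) k)"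
    if "N \<ge> Suc k" for N
    unfolding fps_sum_nth using that
    by (intro sum.mono_neutral_right) (auto intro: fishburn_term_nth_eq_0)
  then show "\<forall>\<^sub>F N in sequentially. fps_nth (\<Sum>n<N. fishburn_term r n) k =
      fps_nth (Abs_fps (\<lambda>k. \<Sum>n\<le>k. fps_nth (fishburn_term r n) k)) k"
    by (auto intro: eventually_sequentiallyI)
qed

definition padic_abs :: "nat \<Rightarrow> rat \<Rightarrow> real" where
  "padic_abs p x =
     (if x = 0 then 0
      else real p powi (int (multiplicity (int p) (snd (quotient_of x)))
                        - int (multiplicity (int p) (fst (quotient_of x)))))"

definition padic_expansion :: "nat \<Rightarrow> rat \<Rightarrow> (nat \<Rightarrow> nat) \<Rightarrow> bool" where
  "padic_expansion p x d \<longleftrightarrow>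
     (\<forall>k. d k < p) \<and> (\<lambda>N. padic_abs p (x - (\<Sum>k<N. of_nat (d k * p ^ k)))) \<longlonglongrightarrow> 0"

text \<open>The description is well defined when \<open>p\<close> is prime and does not divide the denominator of \<open>x\<close>,
  by the lemmas \<open>padic_expansion_unique\<close> and \<open>padic_expansion_exists\<close> below. Digits are numbered from 0.\<close>

definition padic_digit :: "nat \<Rightarrow> rat \<Rightarrow> nat \<Rightarrow> nat" where
  "padic_digit p x k = (THE d. padic_expansion p x d) k"

lemma padic_abs_nonneg: "padic_abs p x \<ge> 0"
  by (simp add: padic_abs_def)

lemma padic_abs_fraction:
  fixes a b :: int
  assumes p: "prime p" and "a \<noteq> 0" "b \<noteq> 0"
  shows "padic_abs p (of_int a / of_int b) =
           real p powi (int (multiplicity (int p) b) - int (multiplicity (int p) a))"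
proof -
  obtain c d where q: "quotient_of (of_int a / of_int b) = (c, d)" by force
  have d: "d > 0" using q by (rule quotient_of_denom_pos)
  have e: "(of_int a / of_int b :: rat) = of_int c / of_int d" using q by (rule quotient_of_div)
  then have c: "c \<noteq> 0" using assms d by auto
  have "of_int (a * d) = (of_int (c * b) :: rat)"
    using e assms d by (simp add: field_simps)
  then have eq: "a * d = c * b" by (simp only: of_int_eq_iff)
  have pp: "prime_elem (int p)" using p by auto
  have "multiplicity (int p) (a * d) = multiplicity (int p) a + multiplicity (int p) d"
    using pp d assms by (intro prime_elem_multiplicity_mult_distrib) auto
  moreover have "multiplicity (int p) (c * b) = multiplicity (int p) c + multiplicity (int p) b"
    using pp c assms by (intro prime_elem_multiplicity_mult_distrib) auto
  ultimately have "multiplicity (int p) a + multiplicity (int p) d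
      = multiplicity (int p) c + multiplicity (int p) b" using eq by simp
  then have "int (multiplicity (int p) d) - int (multiplicity (int p) c)
      = int (multiplicity (int p) b) - int (multiplicity (int p) a)" by linarith
  then show ?thesis using assms q by (simp add: padic_abs_def)
qed

lemma padic_abs_le_iff:
  assumes p: "prime p"
  shows "padic_abs p x \<le> 1 / real p ^ N \<longleftrightarrow>
    (\<exists>a b :: int. \<not> int p dvd b \<and> x * of_int b = of_int (int p ^ N * a))"
    (is "?L \<longleftrightarrow> ?R")
proof (cases "x = 0")
  case True
  have "?R" using p True by (intro exI[of _ 0] exI[of _ 1]) auto
  then show ?thesis using True by (simp add: padic_abs_def)
next
  case False
  have p1: "real p > 1" using p prime_gt_1_nat by simp
  have pp: "prime_elem (int p)" using p by auto
  have N: "1 / real p ^ N = real p powi (- int N)"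
    by (simp add: power_int_minus field_simps)
  show ?thesis
  proof
    assume L: ?L
    obtain c d where q: "quotient_of x = (c, d)" by force
    have d: "d > 0" using q by (rule quotient_of_denom_pos)
    have x: "x = of_int c / of_int d" using q by (rule quotient_of_div)
    have cop: "coprime c d" using q by (rule quotient_of_coprime)
    have c: "c \<noteq> 0" using x False by auto
    have "real p powi (int (multiplicity (int p) d) - int (multiplicity (int p) c)) \<le> real p powi (- int N)"
      using L c d unfolding x N by (subst (asm) padic_abs_fraction[OF p]) auto
    then have le: "int N + int (multiplicity (int p) d) \<le> int (multiplicity (int p) c)"
      using p1 by (smt (verit) power_int_strict_increasing)
    have nd: "\<not> int p dvd d"
    proof
      assume pd: "int p dvd d"
      then have "multiplicity (int p) d > 0" using d pp
        by (simp add: prime_multiplicity_gt_zero_iff)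
      then have "multiplicity (int p) c > 0" using le by linarith
      then have "int p dvd c" using c pp by (simp add: prime_multiplicity_gt_zero_iff)
      with pd have "is_unit (int p)" using cop coprime_common_divisor by blast
      then show False using pp by (simp add: prime_elem_def)
    qed
    have "int p ^ N dvd c" using le by (intro multiplicity_dvd') auto
    then obtain a where "c = int p ^ N * a" by auto
    then have "x * of_int d = of_int (int p ^ N * a)" using x d by simp
    then show ?R using nd by blast
  next
    assume ?R
    then obtain a b :: int where ab: "\<not> int p dvd b" "x * of_int b = of_int (int p ^ N * a)" by auto
    have b: "b \<noteq> 0" using ab by auto
    have a: "a \<noteq> 0" using ab b False by auto
    have p0: "int p \<noteq> 0" using p by (auto simp: prime_gt_0_nat)
    have x: "x = of_int (int p ^ N * a) / of_int b" using ab b by (simp add: field_simps)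
    have "multiplicity (int p) (int p ^ N * a) = N + multiplicity (int p) a"
      using pp a p0 prime_elem_multiplicity_mult_distrib[OF pp, of "int p ^ N" a]
      by (simp add: multiplicity_same_power)
    moreover have "multiplicity (int p) b = 0" using ab by (simp add: not_dvd_imp_multiplicity_0)
    moreover have "int p ^ N * a \<noteq> 0" using a p0 by simp
    ultimately have "padic_abs p x = real p powi (- int N - int (multiplicity (int p) a))"
      using padic_abs_fraction[OF p _ b, of "int p ^ N * a"] by (simp only: x) simp
    also have "\<dots> \<le> real p powi (- int N)" using p1 by (intro power_int_increasing) auto
    finally show ?L by (simp add: N)
  qed
qed

lemma padic_expansion_unique:
  assumes p: "prime p" and d: "padic_expansion p x d" and e: "padic_expansion p x e"
  shows "d = e"
proof
  fix k
  have p0: "p > 0" using p by (simp add: prime_gt_0_nat)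
  define S where "S f N = (\<Sum>k<N. int (f k * p ^ k))" for f :: "nat \<Rightarrow> nat" and N
  have S: "(\<Sum>k<N. of_nat (f k * p ^ k)) = (of_int (S f N) :: rat)" for f N
    by (simp add: S_def)
  have split: "\<exists>c. S f N = S f (Suc k) + int p ^ Suc k * c" if "N \<ge> Suc k" for f k N
    using that
  proof (induction N rule: dec_induct)
    case base
    show ?case by (intro exI[of _ 0]) simp
  next
    case (step n)
    then obtain c where c: "S f n = S f (Suc k) + int p ^ Suc k * c" by auto
    have "int p ^ n = int p ^ Suc k * int p ^ (n - Suc k)"
      using step by (metis Suc_leD le_add_diff_inverse less_eq_Suc_le power_add)
    then have "S f (Suc n) = S f (Suc k) + int p ^ Suc k * (c + int (f n) * int p ^ (n - Suc k))"
      using c by (simp add: S_def algebra_simps)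
    then show ?case by blast
  qed
  show "d k = e k"
  proof (induction k rule: less_induct)
    case (less k)
    have pos: "1 / real p ^ Suc k > 0" using p0 by simp
    have "\<forall>\<^sub>F N in sequentially. padic_abs p (x - of_int (S d N)) < 1 / real p ^ Suc k"
      using d pos unfolding padic_expansion_def S by (auto intro: order_tendstoD)
    moreover have "\<forall>\<^sub>F N in sequentially. padic_abs p (x - of_int (S e N)) < 1 / real p ^ Suc k"
      using e pos unfolding padic_expansion_def S by (auto intro: order_tendstoD)
    ultimately have "\<forall>\<^sub>F N in sequentially. N \<ge> Suc k \<and> padic_abs p (x - of_int (S d N)) < 1 / real p ^ Suc k
        \<and> padic_abs p (x - of_int (S e N)) < 1 / real p ^ Suc k"
      using eventually_ge_at_top[of "Suc k"] by eventually_elim auto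
    then obtain N where N: "N \<ge> Suc k" "padic_abs p (x - of_int (S d N)) \<le> 1 / real p ^ Suc k"
       "padic_abs p (x - of_int (S e N)) \<le> 1 / real p ^ Suc k"
      by (metis (mono_tags, lifting) eventually_happens less_imp_le sequentially_bot)
    obtain a b where ab: "\<not> int p dvd b" "(x - of_int (S d N)) * of_int b = of_int (int p ^ Suc k * a)"
      using N(2) unfolding padic_abs_le_iff[OF p] by blast
    obtain a' b' where ab': "\<not> int p dvd b'" "(x - of_int (S e N)) * of_int b' = of_int (int p ^ Suc k * a')"
      using N(3) unfolding padic_abs_le_iff[OF p] by blast
    have "of_int ((S e N - S d N) * (b * b')) =
        ((x - of_int (S d N)) * of_int b) * of_int b' - ((x - of_int (S e N)) * of_int b') * (of_int b :: rat)"
      by (simp add: algebra_simps)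
    also have "\<dots> = of_int (int p ^ Suc k * (a * b' - a' * b))"
      unfolding ab ab' by (simp add: algebra_simps)
    finally have "(S e N - S d N) * (b * b') = int p ^ Suc k * (a * b' - a' * b)"
      by (simp only: of_int_eq_iff)
    then have "int p ^ Suc k dvd (S e N - S d N) * (b * b')" by simp
    moreover have "coprime (int p ^ Suc k) (b * b')"
      using ab(1) ab'(1) p by (simp add: prime_imp_coprime)
    ultimately have dv: "int p ^ Suc k dvd S e N - S d N"
      using coprime_dvd_mult_left_iff by blast
    obtain c c' where "S d N = S d (Suc k) + int p ^ Suc k * c" "S e N = S e (Suc k) + int p ^ Suc k * c'"
      using split[OF N(1)] by meson
    moreover have "S d k = S e k" unfolding S_def using less by (intro sum.cong) auto
    ultimately have "S e N - S d N = int p ^ k * (int (e k) - int (d k)) + int p ^ Suc k * (c' - c)"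
      by (simp add: S_def algebra_simps)
    with dv have "int p ^ Suc k dvd int p ^ k * (int (e k) - int (d k))"
      by (metis dvd_add_left_iff dvd_triv_left)
    then have "int p dvd int (e k) - int (d k)"
      using p0 by (simp add: mult.commute)
    moreover have "\<bar>int (e k) - int (d k)\<bar> < int p"
      using d e unfolding padic_expansion_def
      by (smt (verit) of_nat_0_le_iff of_nat_less_iff)
    ultimately show ?case
      by (metis dvd_imp_le_int eq_iff_diff_eq_0 abs_of_nat linorder_not_le of_nat_eq_iff)
  qed
qed

lemma padic_expansion_exists:
  fixes a b :: int
  assumes p: "prime p" and b: "\<not> int p dvd b"
  shows "\<exists>d. padic_expansion p (of_int a / of_int b) d"
proof -
  have p1: "p > 1" using p by (rule prime_gt_1_nat)
  have b0: "b \<noteq> 0" using b by auto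
  have "coprime b (int p)" using b p
    by (metis coprime_commute prime_imp_coprime prime_nat_int_transfer)
  then obtain c where c: "[b * c = 1] (mod int p)" using cong_solve_coprime_int by blast
  define dg where "dg a = nat ((a * c) mod int p)" for a
  have dgp: "dg a < p" for a using p1 by (simp add: dg_def nat_less_iff)
  have "\<exists>a'. a = b * int (dg a) + int p * a'" for a
  proof -
    have "int (dg a) = (a * c) mod int p" using p1 by (simp add: dg_def)
    then have "[b * int (dg a) = b * (a * c)] (mod int p)"
      by (simp add: cong_def mod_mult_right_eq)
    also have "[b * (a * c) = a] (mod int p)"
      using cong_mult[OF cong_refl[of a] c] by (simp add: ac_simps)
    finally have "int p dvd a - b * int (dg a)" by (simp add: cong_iff_dvd_diff dvd_diff_commute)
    then show ?thesis by (auto simp: dvd_def algebra_simps)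
  qed
  then obtain nx where nx: "\<And>a. a = b * int (dg a) + int p * nx a" by metis
  define A where "A k = (nx ^^ k) a" for k
  define d where "d k = dg (A k)" for k
  have "a = b * (\<Sum>k<N. int (d k * p ^ k)) + int p ^ N * A N" for N
  proof (induction N)
    case 0
    show ?case by (simp add: A_def)
  next
    case (Suc N)
    have "A N = b * int (d N) + int p * A (Suc N)"
      using nx[of "A N"] by (simp add: A_def d_def)
    then have "int p ^ N * A N = b * int (d N * p ^ N) + int p ^ Suc N * A (Suc N)"
      by (simp add: algebra_simps)
    with Suc show ?case by (simp add: algebra_simps)
  qed
  then have eq: "of_int a = of_int b * (\<Sum>k<N. of_nat (d k * p ^ k)) + (of_int (int p ^ N * A N) :: rat)" for N
    by (metis (mono_tags, lifting) of_int_add of_int_mult of_int_of_nat_eq of_int_sum sum.cong)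
  have le: "padic_abs p (of_int a / of_int b - (\<Sum>k<N. of_nat (d k * p ^ k))) \<le> 1 / real p ^ N" for N
    unfolding padic_abs_le_iff[OF p] using b b0 eq[of N]
    by (intro exI[of _ "A N"] exI[of _ b]) (simp add: field_simps)
  have "(\<lambda>N. padic_abs p (of_int a / of_int b - (\<Sum>k<N. of_nat (d k * p ^ k)))) \<longlonglongrightarrow> 0"
  proof (rule tendsto_sandwich[OF _ _ tendsto_const])
    show "(\<lambda>N. 1 / real p ^ N) \<longlonglongrightarrow> 0"
      using p1 LIMSEQ_inverse_realpow_zero[of "real p"] by (simp add: field_simps)
  qed (use le in \<open>auto intro!: always_eventually simp: padic_abs_nonneg simp del: of_nat_mult of_nat_power\<close>)
  then show ?thesis
    unfolding padic_expansion_def using dgp by (auto simp: d_def intro!: exI[of _ d])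
qed

text \<open>The product \<open>n * (3 * n - 1)\<close> is always even, so the division by 2 is exact.\<close>

definition S_set :: "nat \<Rightarrow> int \<Rightarrow> int \<Rightarrow> nat set" where
  "S_set p r s =
     {j \<in> {0..p - 1}. \<exists>n :: int. [int j - s = r * (n * (3 * n - 1) div 2)] (mod int p)}"

end

theory Submission
  imports Defs
begin

text \<open>Write \<open>Q = (1 - q) ^ r\<close> and let \<open>S(x) = (1 - x) * (\<Sum>n. (Qx; Q)\<^sub>n * x ^ n)\<close>, so that the Fishburn
  series is \<open>- S'(1)\<close>. Differentiating the functional equation
  \<open>S(x) + Q\<^sup>2 * x ^ 3 * S(Qx) = 1 - Q * x\<^sup>2\<close> at \<open>x = Q ^ K\<close> gives, modulo any power of \<open>q\<close>,
  \<open>H(0) = H(K) + e(K)\<close>, where \<open>H(0)\<close> is \<open>- 2\<close> times the Fishburn series,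
  \<open>e(K)\<close> is the sum of \<open>n * \<chi>(n) * Q ^ ((n\<^sup>2 - 1) / 24)\<close> over \<open>n < 6 * K\<close> (Zagier's strange identity, truncated),
  and \<open>H(K)\<close> is \<open>(-1) ^ K * Q ^ (K * (3 * K + 1) / 2)\<close> times a polynomial in \<open>Q ^ K\<close> and \<open>K\<close> of degree 1 in \<open>K\<close>.
  Since \<open>Q ^ K\<close> is 1 modulo \<open>q\<close>, a high finite difference over \<open>K = p * J\<close> removes that polynomial.
  The Gaussian factors are removed by weights that are powers of \<open>(1 - q) ^ p\<close>,
  so the Fishburn series times a unit in \<open>(1 - q) ^ p\<close> is a combination of powers of \<open>1 - q\<close> with exponents
  in the residue classes of \<open>S(p, r, s)\<close>, whose coefficients have the required divisibility.
  For the refined statement, the terms with \<open>p dvd n\<close> assemble, by the same identity for \<open>(1 - q) ^ (r * p\<^sup>2)\<close>,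
  to \<open>p\<close> times the same unit times a combination of powers with exponents in one class modulo \<open>p\<^sup>2\<close>;
  the digit condition ensures that such powers lose only one factor \<open>p\<close>.\<close>

section \<open>The partial sums of a two-variable series\<close>

text \<open>The q-Pochhammer symbol (Qy; Q)_n. The product starts at \<open>Q * y\<close>, so at
  \<open>y = 1\<close> it is a Fishburn product; the factor \<open>1 - y\<close> stands outside, in
  \<open>qser\<close>.\<close>

definition qpoch :: "'a::comm_ring_1 \<Rightarrow> 'a \<Rightarrow> nat \<Rightarrow> 'a" where
  "qpoch Q y n = (\<Prod>j=1..n. 1 - Q ^ j * y)"

definition qser :: "'a::comm_ring_1 \<Rightarrow> 'a \<Rightarrow> nat \<Rightarrow> 'a" where
  "qser Q y N = (1 - y) * (\<Sum>n<N. qpoch Q y n * y ^ n)"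

text \<open>The defect of the functional equation when the series is cut after \<open>N\<close>
  terms. Its last factor makes the empty sum exact and lets the induction on \<open>N\<close>
  close.\<close>

definition qrem :: "'a::comm_ring_1 \<Rightarrow> 'a \<Rightarrow> nat \<Rightarrow> 'a" where
  "qrem Q y N = qpoch Q y N * y ^ N * (Q ^ (N + 1) * y\<^sup>2 - 1)"

lemma qpoch_Suc: "qpoch Q y (Suc n) = qpoch Q y n * (1 - Q ^ Suc n * y)"
  by (simp add: qpoch_def)

lemma qpoch_shift: "(1 - Q * y) * qpoch Q (Q * y) n = qpoch Q y (Suc n)"
proof (induction n)
  case 0
  then show ?case by (simp add: qpoch_def)
next
  case (Suc n)
  have "(1 - Q * y) * qpoch Q (Q * y) (Suc n)
      = ((1 - Q * y) * qpoch Q (Q * y) n) * (1 - Q ^ Suc (Suc n) * y)"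
    by (simp add: qpoch_Suc algebra_simps)
  then show ?case
    unfolding Suc by (simp only: qpoch_Suc[of Q y "Suc n"])
qed

lemma qser_functional:
  "qser Q y N + Q\<^sup>2 * y ^ 3 * qser Q (Q * y) N = 1 - Q * y\<^sup>2 + qrem Q y N"
proof (induction N)
  case 0
  show ?case by (simp add: qser_def qrem_def qpoch_def)
next
  case (Suc N)
  define P where "P = qpoch Q y N"
  define P' where "P' = qpoch Q (Q * y) N"
  \<comment> \<open>This turns both Pochhammer products into multiples of \<open>P\<close>, leaving
    a polynomial identity.\<close>
  have 1: "(1 - Q * y) * P' = P * (1 - Q ^ Suc N * y)"
    unfolding P'_def qpoch_shift by (simp add: P_def qpoch_Suc algebra_simps)
  have "qser Q y (Suc N) + Q\<^sup>2 * y ^ 3 * qser Q (Q * y) (Suc N)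
     = (qser Q y N + Q\<^sup>2 * y ^ 3 * qser Q (Q * y) N)
       + (1 - y) * P * y ^ N + Q\<^sup>2 * y ^ 3 * ((1 - Q * y) * P') * (Q * y) ^ N"
    by (simp add: qser_def P_def P'_def algebra_simps)
  also have "\<dots> = 1 - Q * y\<^sup>2 + P * y ^ N * (Q ^ (N + 1) * y\<^sup>2 - 1)
       + (1 - y) * P * y ^ N + Q\<^sup>2 * y ^ 3 * ((1 - Q * y) * P') * (Q * y) ^ N"
    unfolding Suc qrem_def P_def ..
  also have "\<dots> = 1 - Q * y\<^sup>2 + P * (1 - Q ^ Suc N * y) * y ^ Suc N * (Q ^ (N + 2) * y\<^sup>2 - 1)"
    unfolding 1 by (simp add: algebra_simps power2_eq_square power3_eq_cube)
  also have "\<dots> = 1 - Q * y\<^sup>2 + qrem Q y (Suc N)"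
    by (simp add: P_def qrem_def qpoch_Suc)
  finally show ?case .
qed

text \<open>The truncated series as a polynomial in \<open>y\<close> with \<open>Q\<close> in the
  coefficients, so that \<open>pderiv\<close> differentiates in \<open>y\<close> alone.\<close>

definition T_poly :: "'a::idom \<Rightarrow> nat \<Rightarrow> 'a poly" where
  "T_poly Q = qser [:Q:] [:0, 1:]"

definition rem_poly :: "'a::idom \<Rightarrow> nat \<Rightarrow> 'a poly" where
  "rem_poly Q = qrem [:Q:] [:0, 1:]"

lemma poly_T_poly [simp]: "poly (T_poly Q N) y = qser Q y N"
  by (simp add: T_poly_def qser_def qpoch_def poly_sum poly_prod mult.commute)

lemma pcompose_power: "pcompose (p ^ n) q = pcompose p q ^ n" for p q :: "'a::idom poly"
  by (induction n) (simp_all add: pcompose_mult pcompose_1)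

lemma pcompose_T_poly: "pcompose (T_poly Q N) [:0, Q:] = qser [:Q:] ([:Q:] * [:0, 1:]) N"
  by (simp add: T_poly_def qser_def qpoch_def pcompose_sum pcompose_prod pcompose_mult
      pcompose_diff pcompose_power pcompose_1 pcompose_pCons)

lemma T_poly_functional:
  "T_poly Q N + [:Q:]\<^sup>2 * [:0, 1:] ^ 3 * pcompose (T_poly Q N) [:0, Q:]
       = 1 - [:Q:] * [:0, 1:]\<^sup>2 + rem_poly Q N"
  unfolding pcompose_T_poly unfolding T_poly_def rem_poly_def by (rule qser_functional)

text \<open>Product and chain rule applied to \<open>T_poly_functional\<close>; the third factor
  \<open>Q\<close> is the inner derivative of \<open>Q * y\<close>.\<close>

lemma qser_functional_deriv:
  fixes Q y :: "'a::idom" and N :: nat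
  defines "D \<equiv> pderiv (T_poly Q N)"
  shows "poly D y + 3 * Q\<^sup>2 * y\<^sup>2 * qser Q (Q * y) N + Q ^ 3 * y ^ 3 * poly D (Q * y)
       = - (2 * Q * y) + poly (pderiv (rem_poly Q N)) y"
proof -
  have "poly (pderiv (T_poly Q N + [:Q:]\<^sup>2 * [:0, 1:] ^ 3 * pcompose (T_poly Q N) [:0, Q:])) y
     = poly (pderiv (1 - [:Q:] * [:0, 1:]\<^sup>2 + rem_poly Q N)) y"
    by (simp only: T_poly_functional)
  then show ?thesis
    unfolding power2_eq_square power3_eq_cube D_def
    by (simp add: pderiv_add pderiv_mult pderiv_diff pderiv_pcompose pderiv_pCons
         poly_pcompose algebra_simps del: mult_pCons_left mult_pCons_right)
qed

section \<open>Congruences modulo powers of the variable\<close>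

lemma fps_X_power_dvd_iff_nth:
  fixes f :: "'a::comm_ring_1 fps"
  shows "fps_X ^ n dvd f \<longleftrightarrow> (\<forall>i<n. f $ i = 0)"
proof
  assume "fps_X ^ n dvd f"
  then show "\<forall>i<n. f $ i = 0" by (auto simp: dvd_def fps_X_power_mult_nth)
next
  assume "\<forall>i<n. f $ i = 0"
  then have "f = fps_X ^ n * fps_shift n f"
    by (intro fps_ext) (auto simp: fps_X_power_mult_nth)
  then show "fps_X ^ n dvd f" by (rule dvdI)
qed

lemma fps_X_dvd_iff_nth: "fps_X dvd f \<longleftrightarrow> f $ 0 = 0" for f :: "'a::comm_ring_1 fps"
  using fps_X_power_dvd_iff_nth[of 1 f] by simp

text \<open>Each factor \<open>1 - Q ^ j * y\<close> has constant term 0, and the derivative of the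
  product loses only one factor per summand.\<close>

lemma qpoch_dvd:
  fixes Q y :: "'a::idom fps"
  assumes "Q $ 0 = 1" "y $ 0 = 1"
  shows "fps_X ^ n dvd qpoch Q y n"
    and "fps_X ^ (n - 1) dvd poly (pderiv (qpoch [:Q:] [:0, 1:] n)) y"
proof -
  have f: "fps_X dvd (1 - Q ^ Suc n * y)" for n
    using assms by (simp add: fps_X_dvd_iff_nth fps_nth_power_0 del: power_Suc)
  have e: "poly (qpoch [:Q:] [:0, 1:] n) y = qpoch Q y n" for n
    by (simp add: qpoch_def poly_prod mult.commute)
  have e': "poly (pderiv (qpoch [:Q:] [:0, 1:] (Suc n))) y =
     poly (pderiv (qpoch [:Q:] [:0, 1:] n)) y * (1 - Q ^ Suc n * y) - qpoch Q y n * Q ^ Suc n" for n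
    by (simp add: qpoch_Suc pderiv_mult pderiv_diff pderiv_pCons poly_const_pow e algebra_simps
         del: mult_pCons_left mult_pCons_right power_Suc)
  show 1: "fps_X ^ n dvd qpoch Q y n" for n
    by (induction n) (simp_all only: qpoch_Suc power_0 one_dvd power_Suc2[of fps_X] mult_dvd_mono f)
  show "fps_X ^ (n - 1) dvd poly (pderiv (qpoch [:Q:] [:0, 1:] n)) y"
  proof (induction n)
    case 0
    then show ?case by simp
  next
    case (Suc n)
    have "fps_X ^ n dvd poly (pderiv (qpoch [:Q:] [:0, 1:] n)) y * (1 - Q ^ Suc n * y)"
    proof (cases n)
      case 0
      then show ?thesis by simp
    next
      case (Suc k)
      then show ?thesis using mult_dvd_mono[OF Suc.IH f[of n]] by (simp add: mult.commute)
    qed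
    then show ?case using 1[of n] unfolding e' by simp
  qed
qed

text \<open>The exponent \<open>N - 1\<close> suits both claims: differentiation costs one
  factor.\<close>

lemma qrem_dvd:
  fixes Q y :: "'a::idom fps"
  assumes "Q $ 0 = 1" "y $ 0 = 1"
  shows "fps_X ^ (N - 1) dvd qrem Q y N"
    and "fps_X ^ (N - 1) dvd poly (pderiv (rem_poly Q N)) y"
proof -
  have *: "fps_X ^ (N - 1) dvd qpoch Q y N"
    using qpoch_dvd(1)[OF assms, of N] by (meson diff_le_self dvd_trans le_imp_power_dvd)
  show "fps_X ^ (N - 1) dvd qrem Q y N" using * by (simp add: qrem_def)
  have e: "poly (qpoch [:Q:] [:0, 1:] N) y = qpoch Q y N"
    by (simp add: qpoch_def poly_prod mult.commute)
  show "fps_X ^ (N - 1) dvd poly (pderiv (rem_poly Q N)) y"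
    using * qpoch_dvd(2)[OF assms, of N]
    unfolding rem_poly_def qrem_def mult.assoc
    by (simp only: pderiv_mult poly_add poly_mult e dvd_add dvd_mult2 dvd_mult)
qed

section \<open>Telescoping\<close>

text \<open>The Kronecker symbol (12/n), an even Dirichlet character modulo 12.\<close>

definition chi12 :: "nat \<Rightarrow> int" where
  "chi12 n = (if n mod 12 \<in> {1, 11} then 1 else if n mod 12 \<in> {5, 7} then -1 else 0)"

text \<open>The division by 24 is exact where \<open>chi12 n\<close> is nonzero; the other terms vanish.\<close>

definition theta_sum :: "int fps \<Rightarrow> nat \<Rightarrow> int fps" where
  "theta_sum Q K = (\<Sum>n<6 * K. of_int (int n * chi12 n) * Q ^ ((n\<^sup>2 - 1) div 24))"

text \<open>Differentiating \<open>y ^ 3\<close> in the functional equation and multiplying by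
  \<open>2 * y\<close> adds six copies of the shifted series. The coefficient
  \<open>6 * K + 1\<close> then becomes \<open>6 * Suc K + 1\<close>, so the recurrence
  closes.\<close>

definition Z_val :: "int fps \<Rightarrow> nat \<Rightarrow> nat \<Rightarrow> int fps" where
  "Z_val Q N K = 2 * Q ^ K * poly (pderiv (T_poly Q N)) (Q ^ K)
     + of_nat (6 * K + 1) * qser Q (Q ^ K) N"

text \<open>Consecutive prefactors have ratio \<open>- Q ^ (3 * K + 2)\<close>, which makes the
  recurrence of \<open>Z_val\<close> telescope.\<close>

definition H_val :: "int fps \<Rightarrow> nat \<Rightarrow> nat \<Rightarrow> int fps" where
  "H_val Q N K = (-1) ^ K * Q ^ (K * (3 * K + 1) div 2) * Z_val Q N K"

text \<open>Add \<open>2 * y\<close> times the differentiated equation to \<open>6 * K + 1\<close>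
  times the functional equation at \<open>y = Q ^ K\<close>; the difference consists of the two
  remainders.\<close>

lemma Z_val_step:
  assumes "Q $ 0 = 1"
  shows "fps_X ^ (N - 1) dvd
    Z_val Q N K + Q ^ (3 * K + 2) * Z_val Q N (Suc K)
     - (of_nat (6 * K + 1) - of_nat (6 * K + 5) * Q ^ (2 * K + 1))"
proof -
  define y where "y = Q ^ K"
  have y: "y $ 0 = 1" using assms by (simp add: y_def fps_nth_power_0)
  have 2: "Q ^ (2 * K + 1) = Q * y\<^sup>2" "Q ^ (3 * K + 2) = Q\<^sup>2 * y ^ 3" "Q ^ Suc K = Q * y"
    by (simp_all add: y_def power_add power_mult[symmetric] ac_simps mult_2 flip: power2_eq_square)
  define t where "t = qser Q y N"
  define t' where "t' = qser Q (Q * y) N"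
  define d where "d = poly (pderiv (T_poly Q N)) y"
  define d' where "d' = poly (pderiv (T_poly Q N)) (Q * y)"
  define r where "r = qrem Q y N"
  define r' where "r' = poly (pderiv (rem_poly Q N)) y"
  define k :: "int fps" where "k = of_nat K"
  have t: "t = 1 - Q * y\<^sup>2 + r - Q\<^sup>2 * y ^ 3 * t'"
    using qser_functional[of Q y N] by (simp add: t_def t'_def r_def algebra_simps)
  have d: "d = - (2 * Q * y) + r' - 3 * Q\<^sup>2 * y\<^sup>2 * t' - Q ^ 3 * y ^ 3 * d'"
    using qser_functional_deriv[of Q N y] by (simp add: d_def d'_def r'_def t'_def algebra_simps)
  have "Z_val Q N K + Q ^ (3 * K + 2) * Z_val Q N (Suc K)
     - (of_nat (6 * K + 1) - of_nat (6 * K + 5) * Q ^ (2 * K + 1))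
     = (2 * y * d + (6 * k + 1) * t) + Q\<^sup>2 * y ^ 3 * (2 * Q * y * d' + (6 * k + 7) * t')
       - ((6 * k + 1) - (6 * k + 5) * (Q * y\<^sup>2))"
    unfolding Z_val_def 2 y_def[symmetric] t_def t'_def d_def d'_def k_def
    by (simp add: algebra_simps)
  also have "\<dots> = 2 * y * r' + (6 * k + 1) * r"
    unfolding t d by (simp add: algebra_simps power2_eq_square power3_eq_cube)
  also have "fps_X ^ (N - 1) dvd \<dots>"
    using qrem_dvd[OF assms y] unfolding r_def r'_def by simp
  finally show ?thesis .
qed

text \<open>Among the six new indices only \<open>6 * K + 1\<close> and \<open>6 * K + 5\<close> are
  coprime to 6, and their character values are opposite.\<close>

lemma theta_sum_Suc:
  "theta_sum Q (Suc K) = theta_sum Q K + (-1) ^ K * Q ^ (K * (3 * K + 1) div 2) *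
     (of_nat (6 * K + 1) - of_nat (6 * K + 5) * Q ^ (2 * K + 1))"
proof -
  have s: "sum f {..<a + 6} = sum f {..<a} + f a + f (a+1) + f (a+2) + f (a+3) + f (a+4) + f (a+5)"
    for f :: "nat \<Rightarrow> int fps" and a
    by (simp add: eval_nat_numeral)
  have 6: "6 * Suc K = 6 * K + 6" by simp
  have c: "chi12 (6*K) = 0" "chi12 (6*K+1) = (-1)^K" "chi12 (6*K+2) = 0" "chi12 (6*K+3) = 0"
    "chi12 (6*K+4) = 0" "chi12 (6*K+5) = -((-1)^K)"
    unfolding chi12_def by (cases "even K"; elim evenE oddE; simp; presburger)+
  have ev: "even (K * (3 * K + 1))" by simp
  have e1: "((6*K+1)\<^sup>2 - 1) div 24 = K * (3 * K + 1) div 2"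
  proof -
    have "(6*K+1)\<^sup>2 - 1 = 12 * (K * (3 * K + 1))" by (simp add: power2_eq_square algebra_simps)
    then show ?thesis using ev by (simp add: div_mult_mult1[of 12 _ 2, simplified])
  qed
  have e2: "((6*K+5)\<^sup>2 - 1) div 24 = K * (3 * K + 1) div 2 + (2 * K + 1)"
  proof -
    have "(6*K+5)\<^sup>2 - 1 = 12 * (K * (3 * K + 1) + 2 * (2 * K + 1))"
      by (simp add: power2_eq_square algebra_simps)
    then show ?thesis using ev by (simp only:) (simp add: div_mult_mult1[of 12 _ 2, simplified])
  qed
  show ?thesis unfolding theta_sum_def 6 s c e1 e2 power_add
    by (simp add: algebra_simps)
qed

lemma H_val_telescope:
  assumes "Q $ 0 = 1"
  shows "fps_X ^ (N - 1) dvd H_val Q N 0 - H_val Q N K - theta_sum Q K"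
proof (induction K)
  case 0
  then show ?case by (simp add: theta_sum_def)
next
  case (Suc K)
  have "(K * (3 * K + 1) + 2 * (3 * K + 2)) div 2 = K * (3 * K + 1) div 2 + (3 * K + 2)"
    by simp
  moreover have "Suc K * (3 * Suc K + 1) = K * (3 * K + 1) + 2 * (3 * K + 2)" by (simp add: algebra_simps)
  ultimately have e: "Suc K * (3 * Suc K + 1) div 2 = K * (3 * K + 1) div 2 + (3 * K + 2)" by simp
  have "H_val Q N 0 - H_val Q N (Suc K) - theta_sum Q (Suc K)
      = (H_val Q N 0 - H_val Q N K - theta_sum Q K)
       + (-1) ^ K * Q ^ (K * (3 * K + 1) div 2) * (Z_val Q N K + Q ^ (3 * K + 2) * Z_val Q N (Suc K)
     - (of_nat (6 * K + 1) - of_nat (6 * K + 5) * Q ^ (2 * K + 1)))"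
    unfolding theta_sum_Suc H_val_def e power_add by (simp add: algebra_simps)
  then show ?case using Suc Z_val_step[OF assms, of N K] by (simp only: dvd_add dvd_mult)
qed

text \<open>At \<open>y = 1\<close> the factor \<open>1 - y\<close> kills the series itself, and in
  the derivative only the term from that factor survives.\<close>

lemma H_val_0:
  "H_val Q N 0 = - 2 * (\<Sum>n<N. \<Prod>j=1..n. (1 - Q ^ j))"
  by (simp add: H_val_def Z_val_def T_poly_def pderiv_mult pderiv_diff pderiv_pCons poly_sum poly_prod
     qser_def qpoch_def del: mult_pCons_left mult_pCons_right)

section \<open>Finite differences\<close>

lemma alternating_binomial_sum:
  fixes z :: "'a::comm_ring_1"
  shows "(\<Sum>J\<le>m. (-1) ^ J * of_nat (m choose J) * z ^ J) = (1 - z) ^ m"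
  using binomial_ring[of "- z" 1 m]
  by (simp add: power_minus[of z] ac_simps)

text \<open>Absorbing \<open>J\<close> into the binomial coefficient costs one power of
  \<open>1 - z\<close>.\<close>

lemma alternating_binomial_sum_linear:
  fixes z :: "'a::comm_ring_1"
  shows "(\<Sum>J\<le>Suc m. (-1) ^ J * of_nat (Suc m choose J) * of_nat J * z ^ J) = - of_nat (Suc m) * z * (1 - z) ^ m"
proof -
  have "(\<Sum>J\<le>Suc m. (-1) ^ J * of_nat (Suc m choose J) * of_nat J * z ^ J)
     = (\<Sum>J\<le>m. (-1) ^ Suc J * of_nat (Suc J * (Suc m choose Suc J)) * z ^ Suc J)"
    by (subst sum.atMost_Suc_shift)
      (simp add: ac_simps del: binomial_Suc_Suc of_nat_Suc mult_Suc mult_Suc_right)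
  also have "\<dots> = (\<Sum>J\<le>m. - of_nat (Suc m) * z * ((-1) ^ J * of_nat (m choose J) * z ^ J))"
    by (simp only: Suc_times_binomial of_nat_mult power_Suc)
      (simp only: ac_simps mult_minus_left mult_1_left mult_minus_right)
  also have "\<dots> = - of_nat (Suc m) * z * (1 - z) ^ m"
    by (simp only: sum_distrib_left[symmetric] alternating_binomial_sum)
  finally show ?thesis .
qed

text \<open>Expanding \<open>T\<close> in monomials gives binomial sums at
  \<open>z = B * Q ^ (a * i)\<close>. As \<open>z\<close> has constant term 1, powers of
  \<open>1 - z\<close> are divisible by powers of the variable; the part linear in \<open>J\<close>
  loses one power, hence \<open>Suc m\<close>.\<close>

lemma finite_difference_dvd:
  fixes T :: "'a::comm_ring_1 fps poly" and Q B c d :: "'a fps"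
  assumes "Q $ 0 = 1" "B $ 0 = 1"
  shows "fps_X ^ m dvd (\<Sum>J\<le>Suc m. (-1) ^ J * of_nat (Suc m choose J) * B ^ J *
            ((c + d * of_nat J) * poly T (Q ^ (a * J))))"
proof -
  define n where "n = degree T"
  have pow: "fps_X ^ k dvd (1 - z) ^ k" if "z $ 0 = 1" for k and z :: "'a fps"
    using that by (intro dvd_power_same) (simp add: fps_X_dvd_iff_nth)
  have "fps_X ^ m dvd (\<Sum>i\<le>n. coeff T i * (c * (1 - B * Q ^ (a * i)) ^ Suc m +
     d * (- of_nat (Suc m) * (B * Q ^ (a * i)) * (1 - (B * Q ^ (a * i))) ^ m)))"
  proof (intro dvd_sum dvd_mult dvd_add)
    fix i
    have z: "(B * Q ^ (a * i)) $ 0 = 1" using assms by (simp add: fps_nth_power_0)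
    show "fps_X ^ m dvd (1 - (B * Q ^ (a * i))) ^ m" by (rule pow[OF z])
    show "fps_X ^ m dvd (1 - B * Q ^ (a * i)) ^ Suc m"
      using pow[OF z, of m] by (simp del: One_nat_def)
  qed
  also have "\<dots> = (\<Sum>i\<le>n. coeff T i * (c * (\<Sum>J\<le>Suc m. (-1) ^ J * of_nat (Suc m choose J) * (B * Q ^ (a * i)) ^ J)
     + d * (\<Sum>J\<le>Suc m. (-1) ^ J * of_nat (Suc m choose J) * of_nat J * (B * Q ^ (a * i)) ^ J)))"
    by (simp only: alternating_binomial_sum alternating_binomial_sum_linear)
  also have "\<dots> = (\<Sum>i\<le>n. \<Sum>J\<le>Suc m. (-1) ^ J * of_nat (Suc m choose J) * B ^ J *
            ((c + d * of_nat J) * (coeff T i * (Q ^ (a * J)) ^ i)))"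
    unfolding sum_distrib_left sum.distrib[symmetric]
    by (intro sum.cong refl) (simp add: algebra_simps power_mult_distrib flip: power_mult)
  also have "\<dots> = (\<Sum>J\<le>Suc m. \<Sum>i\<le>n. (-1) ^ J * of_nat (Suc m choose J) * B ^ J *
            ((c + d * of_nat J) * (coeff T i * (Q ^ (a * J)) ^ i)))"
    by (rule sum.swap)
  also have "\<dots> = (\<Sum>J\<le>Suc m. (-1) ^ J * of_nat (Suc m choose J) * B ^ J *
            ((c + d * of_nat J) * poly T (Q ^ (a * J))))"
    unfolding poly_altdef n_def sum_distrib_left ..
  finally show ?thesis .
qed

lemma Z_val_difference:
  assumes "Q $ 0 = 1" "B $ 0 = 1"
  shows "fps_X ^ m dvd (\<Sum>J\<le>Suc m. (-1) ^ J * of_nat (Suc m choose J) * B ^ J * Z_val Q N (a * J))"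
proof -
  have "(\<Sum>J\<le>Suc m. (-1) ^ J * of_nat (Suc m choose J) * B ^ J * Z_val Q N (a * J)) =
    (\<Sum>J\<le>Suc m. (-1) ^ J * of_nat (Suc m choose J) * B ^ J *
            ((2 + 0 * of_nat J) * poly ([:0, 1:] * pderiv (T_poly Q N)) (Q ^ (a * J))))
   + (\<Sum>J\<le>Suc m. (-1) ^ J * of_nat (Suc m choose J) * B ^ J *
            ((1 + of_nat (6 * a) * of_nat J) * poly (T_poly Q N) (Q ^ (a * J))))"
    unfolding sum.distrib[symmetric]
    by (intro sum.cong refl) (simp add: Z_val_def algebra_simps)
  then show ?thesis
    using finite_difference_dvd[OF assms] by (simp only: dvd_add)
qed

section \<open>Integer powers of \<open>1 - q\<close>\<close>

abbreviation pw :: "int \<Rightarrow> int fps" where "pw \<equiv> one_minus_q_powi"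

lemma one_minus_q_powi_Suc: "pw (k + 1) = (1 - fps_X) * pw k"
proof (cases "k \<ge> 0")
  case True
  then show ?thesis by (simp add: one_minus_q_powi_def nat_add_distrib)
next
  case False
  then obtain n where "k = - int (Suc n)"
    by (metis int_cases not_le negD)
  then show ?thesis
    using one_minus_q_mult_geometric
    by (auto simp: one_minus_q_powi_def nat_add_distrib mult.assoc[symmetric])
qed

lemma one_minus_q_powi_add: "pw (a + b) = pw a * pw b"
proof (induction a rule: int_induct[where k = 0])
  case base
  then show ?case by (simp add: one_minus_q_powi_def)
next
  case (step1 a)
  have "pw (a + 1 + b) = (1 - fps_X) * pw (a + b)"
    using one_minus_q_powi_Suc[of "a + b"] by (simp add: algebra_simps)
  then show ?case by (simp only: step1 one_minus_q_powi_Suc mult.assoc)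
next
  case (step2 a)
  have "(1 - fps_X) * pw (a - 1 + b) = pw (a + b)"
    using one_minus_q_powi_Suc[of "a - 1 + b"] by simp
  also have "\<dots> = (1 - fps_X) * pw (a - 1) * pw b"
    using one_minus_q_powi_Suc[of "a - 1"] step2 by simp
  finally have "(1 - fps_X) * pw (a - 1 + b) = (1 - fps_X) * pw (a - 1) * pw b" .
  moreover have "(1 - fps_X :: int fps) \<noteq> 0"
    by (metis one_minus_q_mult_geometric mult_zero_left zero_neq_one)
  ultimately show ?case by (simp add: mult.assoc)
qed

lemma one_minus_q_powi_0 [simp]: "pw 0 = 1"
  by (simp add: one_minus_q_powi_def)

lemma one_minus_q_powi_power: "pw a ^ n = pw (a * int n)"
  by (induction n) (simp_all add: one_minus_q_powi_add distrib_left)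

section \<open>Differential equation and coefficient recurrence of the binomial series\<close>

lemma one_minus_q_powi_deriv: "(1 - fps_X) * fps_deriv (pw k) = - of_int k * pw k"
proof -
  have pos: "(1 - fps_X) * fps_deriv (pw (int n)) = - of_nat n * pw (int n)" for n
  proof (induction n)
    case 0
    show ?case by simp
  next
    case (Suc n)
    have e: "pw (int (Suc n)) = (1 - fps_X) * pw (int n)"
      using one_minus_q_powi_Suc[of "int n"] by (simp add: add.commute)
    have "(1 - fps_X) * fps_deriv (pw (int (Suc n)))
        = (1 - fps_X) * ((1 - fps_X) * fps_deriv (pw (int n))) - (1 - fps_X) * pw (int n)"
      unfolding e by (simp add: algebra_simps)
    also have "\<dots> = - of_nat (Suc n) * ((1 - fps_X) * pw (int n))"
      unfolding Suc by (simp add: algebra_simps)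
    finally show ?case unfolding e .
  qed
  show ?thesis
  proof (cases "k \<ge> 0")
    case True
    then show ?thesis using pos[of "nat k"] by simp
  next
    case False
    \<comment> \<open>A negative exponent is reduced to its positive inverse \<open>g\<close> by
      differentiating \<open>pw k * g = 1\<close> and cancelling \<open>g\<close>.\<close>
    define g where "g = pw (- k)"
    have g: "(1 - fps_X) * fps_deriv g = of_int k * g"
      using pos[of "nat (- k)"] False by (simp add: g_def)
    have fg: "pw k * g = 1" unfolding g_def by (rule one_minus_q_powi_inverse)
    have "fps_deriv (pw k * g) = 0" unfolding fg by simp
    then have "fps_deriv (pw k) * g = - (pw k * fps_deriv g)"
      by (simp add: eq_neg_iff_add_eq_0 mult.commute add.commute)
    then have "(1 - fps_X) * fps_deriv (pw k) * g = - (pw k * ((1 - fps_X) * fps_deriv g))"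
      by (metis mult.assoc mult.left_commute mult_minus_right)
    then have "((1 - fps_X) * fps_deriv (pw k)) * g = (- of_int k * pw k) * g"
      unfolding g by (simp add: algebra_simps)
    moreover have "g \<noteq> 0" using fg by auto
    ultimately show ?thesis using mult_right_cancel by blast
  qed
qed

lemma one_minus_q_powi_nth_Suc:
  "(int n + 1) * pw k $ Suc n = (int n - k) * pw k $ n"
proof -
  have "((1 - fps_X) * fps_deriv (pw k)) $ n = (- of_int k * pw k) $ n"
    by (simp only: one_minus_q_powi_deriv)
  then show ?thesis
    by (cases n) (auto simp: left_diff_distrib algebra_simps fps_of_int[symmetric])
qed

text \<open>With \<open>N = p ^ l * m\<close>, the recurrence reads \<open>(N - i - k) * c(N - i) = (N - i + 1) * c(N - i + 1)\<close>,
  so divisibility passes down from \<open>N * c(N)\<close>; among the factors with \<open>i < p\<close> at most one is divisible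
  by \<open>p\<close>, and by \<open>p\<^sup>2\<close> only if the second digit of \<open>k\<close> is \<open>p - 1\<close>.\<close>

lemma one_minus_q_powi_nth_dvd:
  fixes p :: nat and k :: int
  assumes p: "prime p" and m: "m \<ge> 1" and l: "l \<ge> 1" and j: "1 \<le> j" "j < p"
  shows "k mod int p + int j < int p \<Longrightarrow> int p ^ l dvd pw k $ (p ^ l * m - j)"
    and "(k mod (int p)\<^sup>2) div int p \<noteq> int p - 1 \<Longrightarrow> int p ^ (l - 1) dvd pw k $ (p ^ l * m - j)"
proof -
  define N where "N = p ^ l * m"
  define c where "c i = pw k $ (N - i)" for i
  define e where "e i = int N - int i - k" for i
  have p0: "p > 0" using p prime_gt_0_nat by blast
  have N: "p \<le> N" unfolding N_def using m l p0
    by (intro dvd_imp_le dvd_mult2 dvd_power) auto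
  have pN: "int p ^ l dvd int N" by (simp add: N_def)
  have rec: "e i * c i = (int N - int (i - 1)) * c (i - 1)" if "1 \<le> i" "i < p" for i
  proof -
    have "Suc (N - i) = N - (i - 1)" using that N by simp
    moreover have "int (N - i) = int N - int i" using that N by simp
    ultimately show ?thesis
      using one_minus_q_powi_nth_Suc[of "N - i" k] that by (simp add: e_def c_def algebra_simps)
  qed
  have unit: "int p ^ a dvd c i" if "\<not> int p dvd k + int i" "int p ^ a dvd e i * c i" for a i
  proof -
    have "int p dvd int N" using pN l by (meson dvd_power dvd_trans less_le_trans zero_less_one)
    then have "\<not> int p dvd e i"
      using that(1) dvd_diff[of "int p" "int N" "e i"] by (auto simp: e_def add.commute)
    then have "coprime (int p ^ a) (e i)" using p by (simp add: prime_imp_coprime)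
    then show ?thesis using that(2) coprime_dvd_mult_right_iff by blast
  qed
  have ndvd: "\<not> int p dvd k + int i" if "1 \<le> i" "k mod int p + int i < int p" for i
  proof -
    have "(k + int i) mod int p = k mod int p + int i"
      using that p0 by (subst mod_add_left_eq[symmetric]) (simp add: mod_pos_pos_trivial)
    moreover have "k mod int p \<ge> 0" using p0 by simp
    ultimately show ?thesis using that by (auto simp: dvd_eq_mod_eq_0)
  qed
  have 1: "int p ^ l dvd (int N - int i) * c i" if "i < p" "k mod int p + int i < int p" for i
    using that
  proof (induction i)
    case 0
    then show ?case using pN by simp
  next
    case (Suc i)
    then have "int p ^ l dvd e (Suc i) * c (Suc i)" using rec[of "Suc i"] by simp
    then show ?case using unit ndvd[of "Suc i"] Suc.prems by simp
  qed
  have one': "int p ^ l dvd c i" if "1 \<le> i" "i < p" "k mod int p + int i < int p" for i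
    using unit[OF ndvd] that rec[of i] 1[of "i - 1"] by simp
  show "int p ^ l dvd pw k $ (p ^ l * m - j)" if "k mod int p + int j < int p"
    using one'[OF j that] by (simp add: c_def N_def)
  show "int p ^ (l - 1) dvd pw k $ (p ^ l * m - j)"
    if dg: "(k mod (int p)\<^sup>2) div int p \<noteq> int p - 1"
  proof (cases "l = 1")
    case False
    then have l2: "l \<ge> 2" using l by simp
    have step: "int p ^ (l - 1) dvd c i"
      if i: "1 \<le> i" "i < p" and d: "int p ^ (l - 1) dvd (int N - int (i - 1)) * c (i - 1)" for i
    proof (cases "int p dvd k + int i")
      case False
      then show ?thesis using unit d rec[OF i] by simp
    next
      case True
      have "k mod int p \<ge> 0" "k mod int p < int p" using p0 by simp_all
      moreover have "int p dvd k mod int p + int i"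
        using True by (simp add: dvd_eq_mod_eq_0 mod_add_left_eq)
      ultimately have "k mod int p + int i = int p"
        using i zdvd_not_zless[of "k mod int p + int i - int p" "int p"]
          zdvd_not_zless[of "k mod int p + int i" "int p"]
        by (cases "k mod int p + int i < int p"; cases "k mod int p + int i = int p") (auto simp: dvd_diff)
      \<comment> \<open>The index \<open>i - 1\<close> precedes the only bad one, so the full power
        of \<open>p\<close> is still available there.\<close>
      then have "int p ^ l dvd (int N - int (i - 1)) * c (i - 1)"
        using i by (intro 1) auto
      then have d: "int p ^ l dvd e i * c i" using rec[OF i] by simp
      have pN2: "(int p)\<^sup>2 dvd int N" using pN l2 by (meson dvd_trans le_imp_power_dvd)
      have "int p dvd e i"
        using True dvd_diff[of "int p" "int N" "k + int i"] dvd_trans[OF _ pN2, of "int p"]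
        by (simp add: e_def power2_eq_square algebra_simps)
      then obtain e' where e': "e i = int p * e'" by auto
      \<comment> \<open>Otherwise \<open>k\<close> is \<open>- int i\<close> modulo the square of
        \<open>p\<close>, and its second digit is \<open>p - 1\<close>.\<close>
      have "\<not> int p dvd e'"
      proof
        assume "int p dvd e'"
        then have "(int p)\<^sup>2 dvd e i" unfolding e' power2_eq_square by (rule mult_dvd_mono[OF dvd_refl])
        then have "(int p)\<^sup>2 dvd k + int i"
          using dvd_diff[OF pN2, of "e i"] by (simp add: e_def add.commute)
        then have "k mod (int p)\<^sup>2 = (- int i) mod (int p)\<^sup>2"
          by (simp add: mod_eq_dvd_iff)
        also have "\<dots> = (int p)\<^sup>2 - int i"
        proof -
          have "int i < (int p)\<^sup>2" using i p0 
            using self_le_power[of "int p" 2] by linarith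
          then show ?thesis using i by (simp add: zmod_zminus1_eq_if mod_pos_pos_trivial)
        qed
        also have "\<dots> = (int p - int i) + int p * (int p - 1)"
          by (simp add: power2_eq_square algebra_simps)
        finally have "(k mod (int p)\<^sup>2) div int p = int p - 1"
          using i p0 by simp
        then show False using dg by simp
      qed
      then have "coprime (int p ^ (l - 1)) e'" using p by (simp add: prime_imp_coprime)
      moreover have "int p * int p ^ (l - 1) dvd int p * (e' * c i)"
        using d l unfolding e' by (simp add: mult.assoc flip: power_Suc)
      then have "int p ^ (l - 1) dvd e' * c i" using p0 by simp
      ultimately show ?thesis using coprime_dvd_mult_right_iff by blast
    qed
    have "int p ^ (l - 1) dvd (int N - int i) * c i" if "i < p" for i
      using that
    proof (induction i)
      case 0
      then show ?case using dvd_trans[OF le_imp_power_dvd pN, of "l - 1"] by simp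
    next
      case (Suc i)
      then show ?case using step[of "Suc i"] by simp
    qed
    from step[OF j this] j have "int p ^ (l - 1) dvd c j" by simp
    then show ?thesis unfolding c_def N_def .
  qed simp
qed

section \<open>Spans of powers of \<open>1 - q\<close>\<close>

text \<open>A span records which exponents occur; divisibility of a coefficient need only be tested
  on the generators.\<close>

inductive_set pw_span :: "int set \<Rightarrow> int fps set" for K where
  zero: "0 \<in> pw_span K"
| add: "G \<in> pw_span K \<Longrightarrow> k \<in> K \<Longrightarrow> of_int c * pw k + G \<in> pw_span K"

lemma pw_span_base: "k \<in> K \<Longrightarrow> of_int c * pw k \<in> pw_span K"
  using pw_span.add[OF pw_span.zero, of k K c] by simp

lemma pw_span_add:
  assumes "F \<in> pw_span K" "G \<in> pw_span K" shows "F + G \<in> pw_span K"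
  using assms by (induction rule: pw_span.induct) (auto simp: add.assoc intro: pw_span.intros)

lemma pw_span_of_int:
  assumes "F \<in> pw_span K" shows "of_int c * F \<in> pw_span K"
  using assms
proof (induction rule: pw_span.induct)
  case (add G k d)
  have "of_int c * (of_int d * pw k + G) = of_int (c * d) * pw k + of_int c * G"
    by (simp add: algebra_simps)
  with add show ?case by (metis pw_span.add)
qed (simp add: pw_span.zero)

lemma pw_span_uminus: "F \<in> pw_span K \<Longrightarrow> - F \<in> pw_span K"
  using pw_span_of_int[of F K "-1"] by simp

lemma pw_span_diff: "F \<in> pw_span K \<Longrightarrow> G \<in> pw_span K \<Longrightarrow> F - G \<in> pw_span K"
  using pw_span_add[of F K "- G"] pw_span_uminus by simp

lemma pw_span_sum: "(\<And>i. i \<in> I \<Longrightarrow> f i \<in> pw_span K) \<Longrightarrow> sum f I \<in> pw_span K"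
  by (induction I rule: infinite_finite_induct) (auto intro: pw_span.zero pw_span_add)

lemma pw_span_mult:
  assumes "F \<in> pw_span K" "G \<in> pw_span L" "\<And>a b. a \<in> K \<Longrightarrow> b \<in> L \<Longrightarrow> a + b \<in> M"
  shows "F * G \<in> pw_span M"
  using assms(1)
proof (induction rule: pw_span.induct)
  case zero
  then show ?case by (simp add: pw_span.zero)
next
  case (add F k c)
  have "of_int c * pw k * G \<in> pw_span M"
    using assms(2)
  proof (induction rule: pw_span.induct)
    case zero
    then show ?case by (simp add: pw_span.zero)
  next
    case (add G k' d)
    have "of_int c * pw k * (of_int d * pw k' + G) = of_int (c * d) * pw (k + k') + of_int c * pw k * G"
      by (simp add: one_minus_q_powi_add algebra_simps)
    then show ?case using add assms(3) \<open>k \<in> K\<close> by (metis pw_span.add)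
  qed
  then show ?case using add by (simp add: distrib_right pw_span_add)
qed

lemma pw_span_nth_dvd:
  assumes "F \<in> pw_span K" "\<And>k. k \<in> K \<Longrightarrow> d dvd pw k $ n"
  shows "d dvd F $ n"
  using assms(1) by (induction rule: pw_span.induct) (auto simp: fps_of_int[symmetric] assms(2))

lemma pw_span_one: "0 \<in> K \<Longrightarrow> 1 \<in> pw_span K"
  using pw_span_base[of 0 K 1] by simp

text \<open>A unit of the form \<open>2 ^ m - v\<close> with \<open>v\<close> divisible by \<open>q\<close> is inverted modulo \<open>q ^ M\<close>,
  up to a power of 2, by a finite geometric sum in \<open>v\<close>, which stays in the span.\<close>

lemma pw_span_cancel:
  fixes p :: nat
  assumes p: "prime p" "odd p"
    and u: "u \<in> pw_span {k. int p dvd k}" "u $ 0 = 2 ^ m"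
    and G: "G \<in> pw_span {k. k mod int p + int j < int p}"
    and F: "fps_X ^ M dvd u * F - G"
    and n: "p ^ l * m' - j < M" and m': "m' \<ge> 1" and l: "l \<ge> 1" and j: "1 \<le> j" "j < p"
  shows "int p ^ l dvd F $ (p ^ l * m' - j)"
proof -
  define v where "v = of_int (2 ^ m) - u"
  define w where "w = (\<Sum>i<M. of_int (2 ^ m) ^ (M - Suc i) * v ^ i)"
  define n where "n = p ^ l * m' - j"
  have R: "f * g \<in> pw_span {k. int p dvd k}"
    if "f \<in> pw_span {k. int p dvd k}" "g \<in> pw_span {k. int p dvd k}" for f g
    using that by (rule pw_span_mult) auto
  have R1: "1 \<in> pw_span {k. int p dvd k}" by (rule pw_span_one) simp
  have v: "v \<in> pw_span {k. int p dvd k}"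
    unfolding v_def using pw_span_of_int[OF R1, of "2 ^ m"] u by (auto intro: pw_span_diff)
  have vi: "v ^ i \<in> pw_span {k. int p dvd k}" for i
    by (induction i) (auto intro: R R1 v)
  have w: "w \<in> pw_span {k. int p dvd k}"
    unfolding w_def using pw_span_of_int[OF vi] by (auto intro!: pw_span_sum simp flip: of_int_power)
  have "v $ 0 = 0" by (simp add: v_def u fps_of_int[symmetric])
  then have vM: "fps_X ^ M dvd v ^ M" by (intro dvd_power_same) (simp add: fps_X_dvd_iff_nth)
  have uw: "w * u = of_int (2 ^ m) ^ M - v ^ M"
  proof -
    have "v ^ M - of_int (2 ^ m) ^ M = (v - of_int (2 ^ m)) * w"
      unfolding w_def by (rule power_diff_sumr2)
    then show ?thesis by (simp add: v_def algebra_simps)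
  qed
  have "fps_X ^ M dvd w * (u * F - G) + v ^ M * F"
    using F vM by (intro dvd_add dvd_mult dvd_mult2)
  also have "w * (u * F - G) + v ^ M * F = (w * u + v ^ M) * F - w * G"
    by (simp add: algebra_simps)
  also have "\<dots> = of_int ((2 ^ m) ^ M) * F - w * G"
    unfolding uw by simp
  finally have "(of_int ((2 ^ m) ^ M) * F - w * G) $ n = 0"
    using n unfolding fps_X_power_dvd_iff_nth n_def by blast
  then have eq: "(2 ^ m) ^ M * F $ n = (w * G) $ n"
    by (simp add: fps_of_int[symmetric] del: of_int_power of_int_numeral)
  \<comment> \<open>The exponents in \<open>w\<close> are multiples of \<open>p\<close>, so the
    residues of those in \<open>G\<close> survive.\<close>
  have "w * G \<in> pw_span {k. k mod int p + int j < int p}"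
    using w G by (rule pw_span_mult) (auto simp: mod_add_left_eq dvd_def)
  then have "int p ^ l dvd (w * G) $ n"
    unfolding n_def by (rule pw_span_nth_dvd)
      (use one_minus_q_powi_nth_dvd(1)[OF p(1) m' l j] in auto)
  then have "int p ^ l dvd (2 ^ m) ^ M * F $ n" unfolding eq .
  moreover have "coprime (int p ^ l) ((2 ^ m) ^ M)"
    using p by (simp add: coprime_right_2_iff_odd)
  ultimately show ?thesis unfolding n_def using coprime_dvd_mult_right_iff by blast
qed

section \<open>Properties of the character modulo 12\<close>

lemma chi12_mod: "chi12 (k mod 12) = chi12 k"
  by (simp add: chi12_def)

lemma chi12_mult: "chi12 (m * n) = chi12 m * chi12 n"
proof -
  have small: "k mod 12 \<in> {0,1,2,3,4,5,6,7,8,9,10,11}" for k :: nat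
    by (simp, presburger)
  have "chi12 (a * b) = chi12 a * chi12 b"
    if "a \<in> {0,1,2,3,4,5,6,7,8,9,10,11}" "b \<in> {0,1,2,3,4,5,6,7,8,9,10,11}" for a b
    using that by (elim insertE emptyE; simp add: chi12_def)
  from this[OF small small] have "chi12 ((m mod 12) * (n mod 12)) = chi12 m * chi12 n"
    by (simp only: chi12_mod)
  moreover have "chi12 ((m mod 12) * (n mod 12)) = chi12 (m * n)"
    by (metis chi12_mod mod_mult_eq)
  ultimately show ?thesis by simp
qed

lemma chi12_nonzero_cases:
  assumes "chi12 n \<noteq> 0"
  obtains a :: int where "\<bar>6 * a - 1\<bar> = int n"
proof -
  define k where "k = int (n div 12)"
  have n: "int n = 12 * k + int (n mod 12)"
    unfolding k_def by (metis mult_div_mod_eq of_nat_add of_nat_mult of_nat_numeral)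
  have k0: "k \<ge> 0" by (simp add: k_def)
  have "n mod 12 \<in> {1, 5, 7, 11}" using assms by (auto simp: chi12_def split: if_splits)
  then consider "n mod 12 = 1" | "n mod 12 = 5" | "n mod 12 = 7" | "n mod 12 = 11" by auto
  then show ?thesis
  proof cases
    case 1 then show ?thesis using n k0 by (intro that[of "- 2 * k"]) linarith
  next
    case 2
    then have "int n = 12 * k + 5" using n by simp
    then show ?thesis using k0 by (intro that[of "2 * k + 1"]) (simp add: algebra_simps)
  next
    case 3
    then have "int n = 12 * k + 7" using n by simp
    then show ?thesis using k0 by (intro that[of "- 2 * k - 1"]) (simp add: algebra_simps)
  next
    case 4
    then have "int n = 12 * k + 11" using n by simp
    then show ?thesis using k0 by (intro that[of "2 * k + 2"]) (simp add: algebra_simps)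
  qed
qed

text \<open>As (6a - 1)^2 = 24 * (a(3a - 1)/2) + 1, the theta exponents are generalized pentagonal
  numbers, the ones that define \<open>S_set\<close>.\<close>

lemma chi12_nonzero_square:
  assumes "chi12 n \<noteq> 0"
  obtains a :: int where "int ((n\<^sup>2 - 1) div 24) = a * (3 * a - 1) div 2"
    "n\<^sup>2 = 24 * ((n\<^sup>2 - 1) div 24) + 1"
proof -
  obtain a where a: "\<bar>6 * a - 1\<bar> = int n" using assms by (rule chi12_nonzero_cases)
  have "even (a * (3 * a - 1))" by simp
  then obtain t where t: "a * (3 * a - 1) = 2 * t" by blast
  have "(int n)\<^sup>2 = (6 * a - 1)\<^sup>2" using a by (metis power2_abs)
  also have "\<dots> = 12 * (a * (3 * a - 1)) + 1" by (simp add: power2_eq_square algebra_simps)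
  finally have sq: "int (n\<^sup>2) = 24 * t + 1" unfolding t by simp
  then have "t \<ge> 0" by (smt (verit) of_nat_0_le_iff)
  then obtain t' where t': "t = int t'" by (metis nonneg_int_cases)
  have n2: "n\<^sup>2 = 24 * t' + 1" using sq unfolding t' by (simp add: nat_int_comparison(1))
  show ?thesis
    by (rule that[of a]) (use t t' n2 in simp_all)
qed

lemma chi12_prime:
  fixes p :: nat
  assumes "prime p" "p \<ge> 5"
  shows "chi12 p \<noteq> 0"
proof -
  have "\<not> 2 dvd p" "\<not> 3 dvd p"
    using assms primes_dvd_imp_eq[of 2 p] primes_dvd_imp_eq[of 3 p] by auto
  then have "p mod 12 \<in> {1, 5, 7, 11}" by (simp, presburger)
  then show ?thesis by (auto simp: chi12_def)
qed

section \<open>The key congruence\<close>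

text \<open>The condition on \<open>W\<close> turns the weighted sum of \<open>H_val\<close> at
  \<open>a * J\<close> into the finite difference of \<open>Z_val_difference\<close>, so only the
  theta sums remain. The truncation at \<open>Suc M\<close> gives \<open>M\<close> in
  \<open>H_val_telescope\<close>.\<close>

lemma sum_Z_val_weighted:
  fixes W :: "nat \<Rightarrow> int fps"
  assumes Q: "Q $ 0 = 1" and B: "B $ 0 = 1"
    and W: "\<And>J. W J * ((-1) ^ (a * J) * Q ^ ((a * J) * (3 * (a * J) + 1) div 2)) = (-1) ^ J * B ^ J"
  shows "fps_X ^ M dvd (\<Sum>J\<le>Suc M. of_nat (Suc M choose J) * W J) * H_val Q (Suc M) 0
     - (\<Sum>J\<le>Suc M. of_nat (Suc M choose J) * W J * theta_sum Q (a * J))"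
proof -
  let ?b = "\<lambda>J. of_nat (Suc M choose J) * W J"
  have 1: "fps_X ^ M dvd (\<Sum>J\<le>Suc M. ?b J * (H_val Q (Suc M) 0 - H_val Q (Suc M) (a * J) - theta_sum Q (a * J)))"
    using H_val_telescope[OF Q, of "Suc M"] by (intro dvd_sum dvd_mult) simp
  have "fps_X ^ M dvd (\<Sum>J\<le>Suc M. (-1) ^ J * of_nat (Suc M choose J) * B ^ J * Z_val Q (Suc M) (a * J))"
    by (rule Z_val_difference[OF Q B])
  also have "\<dots> = (\<Sum>J\<le>Suc M. ?b J * H_val Q (Suc M) (a * J))"
  proof (intro sum.cong refl)
    fix J
    have "?b J * H_val Q (Suc M) (a * J) = of_nat (Suc M choose J) *
       (W J * ((-1) ^ (a * J) * Q ^ ((a * J) * (3 * (a * J) + 1) div 2))) * Z_val Q (Suc M) (a * J)"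
      unfolding H_val_def by (simp only: mult.assoc)
    then show "(-1) ^ J * of_nat (Suc M choose J) * B ^ J * Z_val Q (Suc M) (a * J) = ?b J * H_val Q (Suc M) (a * J)"
      unfolding W by (simp only: ac_simps)
  qed
  finally have 2: "fps_X ^ M dvd (\<Sum>J\<le>Suc M. ?b J * H_val Q (Suc M) (a * J))" .
  have "(\<Sum>J\<le>Suc M. ?b J * (H_val Q (Suc M) 0 - H_val Q (Suc M) (a * J) - theta_sum Q (a * J)))
      + (\<Sum>J\<le>Suc M. ?b J * H_val Q (Suc M) (a * J))
    = (\<Sum>J\<le>Suc M. ?b J) * H_val Q (Suc M) 0 - (\<Sum>J\<le>Suc M. ?b J * theta_sum Q (a * J))"
    unfolding sum_distrib_right sum.distrib[symmetric] sum_subtractf[symmetric]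
    by (intro sum.cong refl) (simp only: algebra_simps)
  then show ?thesis using dvd_add[OF 1 2] by simp
qed

text \<open>The weights cancel the power of \<open>(1 - q) ^ r\<close> in \<open>H_val\<close> at \<open>p * J\<close>; for the base
  \<open>(1 - q) ^ (r * p\<^sup>2)\<close> they cancel its quadratic part at \<open>J\<close>, and a \<open>J\<close>-th power remains.\<close>

definition weight :: "nat \<Rightarrow> int \<Rightarrow> nat \<Rightarrow> int fps" where
  "weight p r J = pw (- (r * int (p * (J * (3 * p * J + 1) div 2))))"

text \<open>No signs appear here: \<open>H_val\<close> supplies them at \<open>p * J\<close> for odd
  \<open>p\<close>, and at \<open>J\<close>. The constant term is therefore a power of 2, invertible
  modulo odd \<open>p\<close>.\<close>

definition weight_sum :: "nat \<Rightarrow> int \<Rightarrow> nat \<Rightarrow> int fps" where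
  "weight_sum p r M = (\<Sum>J\<le>Suc M. of_nat (Suc M choose J) * weight p r J)"

lemma weight_sum_span: "weight_sum p r M \<in> pw_span {k. int p dvd k}"
proof -
  have "of_int (int (Suc M choose J)) * pw (- (r * int (p * (J * (3 * p * J + 1) div 2))))
     \<in> pw_span {k. int p dvd k}" for J
    by (rule pw_span_base) simp
  then show ?thesis unfolding weight_sum_def weight_def by (intro pw_span_sum) simp
qed

lemma weight_sum_nth_0: "weight_sum p r M $ 0 = 2 ^ Suc M"
proof -
  have "weight_sum p r M $ 0 = (\<Sum>J\<le>Suc M. int (Suc M choose J))"
    by (simp add: weight_sum_def weight_def fps_sum_nth fps_of_nat[symmetric] del: sum.atMost_Suc)
  also have "\<dots> = 2 ^ Suc M" by (simp only: choose_row_sum flip: of_nat_sum) (simp only: of_nat_power of_nat_numeral)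
  finally show ?thesis .
qed

lemma weight_sum_H_val:
  assumes "odd p"
  shows "fps_X ^ M dvd weight_sum p r M * H_val (pw r) (Suc M) 0
     - (\<Sum>J\<le>Suc M. of_nat (Suc M choose J) * weight p r J * theta_sum (pw r) (p * J))"
  unfolding weight_sum_def
proof (rule sum_Z_val_weighted[where B = 1])
  fix J
  have "even (J * (3 * p * J + 1))" using assms by simp
  then have e: "(p * J) * (3 * (p * J) + 1) div 2 = p * (J * (3 * p * J + 1) div 2)"
    by (simp only: div_mult_swap mult.assoc mult.left_commute[of 3 p])
  have "(-1) ^ (p * J) = ((-1) ^ J :: int fps)" using assms by (simp add: power_mult)
  moreover have "weight p r J * pw r ^ (p * (J * (3 * p * J + 1) div 2)) = 1"
    unfolding weight_def one_minus_q_powi_power by (simp flip: one_minus_q_powi_add)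
  ultimately show "weight p r J * ((-1) ^ (p * J) * pw r ^ ((p * J) * (3 * (p * J) + 1) div 2)) = (-1) ^ J * 1 ^ J"
    unfolding e mult.left_commute[of "weight p r J"] by (simp only: power_one)
qed simp_all

text \<open>The same unit serves the base \<open>pw (r * (int p)\<^sup>2)\<close>, so one
  cancellation can treat both series.\<close>

lemma weight_sum_H_val_square:
  assumes "odd p"
  shows "fps_X ^ M dvd weight_sum p r M * H_val (pw (r * (int p)\<^sup>2)) (Suc M) 0
     - (\<Sum>J\<le>Suc M. of_nat (Suc M choose J) * weight p r J * theta_sum (pw (r * (int p)\<^sup>2)) J)"
proof -
  \<comment> \<open>The quadratic parts p^2 * 3J^2/2 cancel, leaving the linear part (p^2 -
    p)J/2.\<close>
  define b where "b = int p * (int p - 1) div 2"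
  have b: "2 * b = int p * (int p - 1)" by (simp add: b_def)
  have "fps_X ^ M dvd weight_sum p r M * H_val (pw (r * (int p)\<^sup>2)) (Suc M) 0
     - (\<Sum>J\<le>Suc M. of_nat (Suc M choose J) * weight p r J * theta_sum (pw (r * (int p)\<^sup>2)) (1 * J))"
    unfolding weight_sum_def
  proof (rule sum_Z_val_weighted[where B = "pw (r * b)"])
    fix J
    define x where "x = int (J * (3 * p * J + 1) div 2)"
    define y where "y = int (J * (3 * J + 1) div 2)"
    have x: "2 * x = int J * (3 * int p * int J + 1)"
    proof -
      have "even (J * (3 * p * J + 1))" using assms by simp
      then have "2 * (J * (3 * p * J + 1) div 2) = J * (3 * p * J + 1)" by simp
      then have "int (2 * (J * (3 * p * J + 1) div 2)) = int (J * (3 * p * J + 1))" by (rule arg_cong)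
      then show ?thesis unfolding x_def by (simp only: of_nat_1 of_nat_add of_nat_mult of_nat_numeral)
    qed
    have y: "2 * y = int J * (3 * int J + 1)"
    proof -
      have "2 * (J * (3 * J + 1) div 2) = J * (3 * J + 1)" by simp
      then have "int (2 * (J * (3 * J + 1) div 2)) = int (J * (3 * J + 1))" by (rule arg_cong)
      then show ?thesis unfolding y_def by (simp only: of_nat_1 of_nat_add of_nat_mult of_nat_numeral)
    qed
    have "2 * (- (r * (int p * x)) + r * (int p)\<^sup>2 * y)
        = - (r * (int p * (2 * x))) + r * (int p)\<^sup>2 * (2 * y)" by (simp add: algebra_simps)
    also have "\<dots> = r * (int p * (int p - 1)) * int J"
      unfolding x y by (simp add: algebra_simps power2_eq_square)
    also have "\<dots> = 2 * (r * b * int J)" unfolding b[symmetric] by (simp add: algebra_simps)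
    finally have e: "- (r * (int p * x)) + r * (int p)\<^sup>2 * y = r * b * int J" by simp
    have "weight p r J * pw (r * (int p)\<^sup>2) ^ (J * (3 * J + 1) div 2) = pw (r * b) ^ J"
      unfolding weight_def one_minus_q_powi_power of_nat_mult[of p] x_def[symmetric] y_def[symmetric]
        one_minus_q_powi_add[symmetric] e ..
    then show "weight p r J * ((-1) ^ (1 * J) * pw (r * (int p)\<^sup>2) ^ ((1 * J) * (3 * (1 * J) + 1) div 2))
        = (-1) ^ J * pw (r * b) ^ J"
      by (simp add: mult.left_commute)
  qed simp_all
  then show ?thesis by simp
qed

section \<open>Theta sums split by divisibility of the index by p\<close>

definition theta_set :: "int fps \<Rightarrow> nat set \<Rightarrow> int fps" where
  "theta_set Q A = (\<Sum>n\<in>A. of_int (int n * chi12 n) * Q ^ ((n\<^sup>2 - 1) div 24))"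

text \<open>The character is multiplicative and (pn)^2 - 1 = (p^2 - 1) + p^2 (n^2 - 1), so the
  multiples of \<open>p\<close> form a theta sum in \<open>Q ^ p\<^sup>2\<close>.\<close>

lemma theta_sum_split:
  assumes "p > 0" "chi12 p \<noteq> 0"
  shows "theta_sum Q (p * J) = theta_set Q {n. n < 6 * (p * J) \<and> \<not> p dvd n}
     + of_int (int p * chi12 p) * Q ^ ((p\<^sup>2 - 1) div 24) * theta_sum (Q ^ p\<^sup>2) J"
proof -
  let ?t = "\<lambda>n. of_int (int n * chi12 n) * Q ^ ((n\<^sup>2 - 1) div 24)"
  have "{..<6 * (p * J)} = {n. n < 6 * (p * J) \<and> \<not> p dvd n} \<union> ((*) p) ` {..<6 * J}"
    using assms by auto
  then have "theta_sum Q (p * J) = sum ?t ({n. n < 6 * (p * J) \<and> \<not> p dvd n} \<union> ((*) p) ` {..<6 * J})"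
    by (simp only: theta_sum_def)
  also have "\<dots> = theta_set Q {n. n < 6 * (p * J) \<and> \<not> p dvd n} + sum ?t (((*) p) ` {..<6 * J})"
    unfolding theta_set_def by (rule sum.union_disjoint) auto
  also have "sum ?t (((*) p) ` {..<6 * J}) = (\<Sum>n<6 * J. ?t (p * n))"
    using assms by (subst sum.reindex) (auto simp: inj_on_def)
  also have "\<dots> = (\<Sum>n<6 * J. of_int (int p * chi12 p) * Q ^ ((p\<^sup>2 - 1) div 24) *
      (of_int (int n * chi12 n) * (Q ^ p\<^sup>2) ^ ((n\<^sup>2 - 1) div 24)))"
  proof (intro sum.cong refl)
    fix n
    show "?t (p * n) = of_int (int p * chi12 p) * Q ^ ((p\<^sup>2 - 1) div 24) *
      (of_int (int n * chi12 n) * (Q ^ p\<^sup>2) ^ ((n\<^sup>2 - 1) div 24))"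
    proof (cases "chi12 n = 0")
      case False
      define c where "c = (p\<^sup>2 - 1) div 24"
      define d where "d = (n\<^sup>2 - 1) div 24"
      have p2: "p\<^sup>2 = 24 * c + 1" unfolding c_def using assms(2) by (rule chi12_nonzero_square)
      have n2: "n\<^sup>2 = 24 * d + 1" unfolding d_def using False by (rule chi12_nonzero_square)
      have "(p * n)\<^sup>2 - 1 = 24 * (c + p\<^sup>2 * d)"
        unfolding power_mult_distrib n2 p2 by (simp add: algebra_simps)
      then have "((p * n)\<^sup>2 - 1) div 24 = c + p\<^sup>2 * d" by simp
      then show ?thesis
        unfolding c_def[symmetric] d_def[symmetric]
        by (simp add: chi12_mult power_add algebra_simps flip: power_mult)
    qed (simp add: chi12_mult)
  qed
  also have "\<dots> = of_int (int p * chi12 p) * Q ^ ((p\<^sup>2 - 1) div 24) * theta_sum (Q ^ p\<^sup>2) J"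
    by (simp only: theta_sum_def sum_distrib_left)
  finally show ?thesis .
qed

text \<open>The weights have exponents divisible by \<open>p\<close>, so only \<open>s\<close> and
  the theta exponent determine the residue.\<close>

lemma weighted_theta_span:
  assumes A: "\<And>J n. n \<in> A J \<Longrightarrow> chi12 n \<noteq> 0 \<Longrightarrow> (s + r * int ((n\<^sup>2 - 1) div 24)) mod int p + int j < int p"
  shows "pw s * (\<Sum>J\<le>m. of_nat (c J) * weight p r J * theta_set (pw r) (A J))
     \<in> pw_span {k. k mod int p + int j < int p}" (is "_ \<in> ?S")
proof -
  have "pw s * (of_nat (c J) * weight p r J * (of_int (int n * chi12 n) * pw r ^ ((n\<^sup>2 - 1) div 24))) \<in> ?S"
    if n: "n \<in> A J" for n J
  proof (cases "chi12 n = 0")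
    case True
    then show ?thesis by (simp add: pw_span.zero)
  next
    case False
    define g where "g = int ((n\<^sup>2 - 1) div 24)"
    define w where "w = int (J * (3 * p * J + 1) div 2)"
    have "pw s * (of_nat (c J) * weight p r J * (of_int (int n * chi12 n) * pw r ^ ((n\<^sup>2 - 1) div 24)))
      = of_int (int (c J) * (int n * chi12 n)) * pw (s + r * g + int p * (- r * w))"
      unfolding weight_def one_minus_q_powi_power g_def w_def
      by (simp add: one_minus_q_powi_add[symmetric] algebra_simps)
    also have "\<dots> \<in> ?S"
      by (rule pw_span_base) (use A[OF n False] in \<open>simp only: mem_Collect_eq mod_mult_self2 g_def\<close>)
    finally show ?thesis .
  qed
  then show ?thesis unfolding theta_set_def sum_distrib_left by (intro pw_span_sum)
qed

section \<open>The digit condition\<close>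

text \<open>By \<open>g\<close>, \<open>int g\<close> represents -1/24 modulo the square of
  \<open>p\<close>, so \<open>s + r * int g\<close> has the same first two digits as s -
  r/24.\<close>

lemma padic_digit_one:
  fixes p g :: nat and r s :: int
  assumes p: "prime p" and g: "p\<^sup>2 = 24 * g + 1"
  shows "int (padic_digit p (of_int s - of_int r / 24) 1) = ((s + r * int g) mod (int p)\<^sup>2) div int p"
proof -
  define x :: rat where "x = of_int s - of_int r / 24"
  have p0: "int p > 0" using p by (simp add: prime_gt_0_nat)
  have gi: "(int p)\<^sup>2 = 24 * int g + 1"
    using arg_cong[OF g, of int] by simp
  have n24: "\<not> int p dvd 24"
  proof
    assume "int p dvd 24"
    then have "int p dvd (int p)\<^sup>2 - 24 * int g"
      by (intro dvd_diff) (auto simp: power2_eq_square)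
    then show False using p gi by simp
  qed
  have x: "x = of_int (24 * s - r) / of_int 24" by (simp add: x_def field_simps)
  obtain d where d: "padic_expansion p x d" using padic_expansion_exists[OF p n24] x by metis
  have "(THE d. padic_expansion p x d) = d"
    using d padic_expansion_unique[OF p] by blast
  then have dig: "padic_digit p x 1 = d 1" by (simp add: padic_digit_def)
  define S where "S N = (\<Sum>k<N. int (d k * p ^ k))" for N
  have S: "(\<Sum>k<N. of_nat (d k * p ^ k)) = (of_int (S N) :: rat)" for N
    by (simp add: S_def)
  have "1 / real p ^ 2 > 0" using p0 by simp
  then have "\<forall>\<^sub>F N in sequentially. padic_abs p (x - of_int (S N)) < 1 / real p ^ 2"
    using d unfolding padic_expansion_def S by (auto intro: order_tendstoD)
  then have "\<forall>\<^sub>F N in sequentially. N \<ge> 2 \<and> padic_abs p (x - of_int (S N)) < 1 / real p ^ 2"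
    using eventually_ge_at_top[of 2] by eventually_elim auto
  then obtain N where N: "N \<ge> 2" "padic_abs p (x - of_int (S N)) \<le> 1 / real p ^ 2"
    by (metis (mono_tags, lifting) eventually_happens less_imp_le sequentially_bot)
  obtain a b where ab: "\<not> int p dvd b" "(x - of_int (S N)) * of_int b = of_int (int p ^ 2 * a)"
    using N(2) unfolding padic_abs_le_iff[OF p] by blast
  have "of_int ((24 * s - r - 24 * S N) * b) = 24 * ((x - of_int (S N)) * (of_int b :: rat))"
    by (simp add: x_def algebra_simps)
  also have "\<dots> = of_int ((int p)\<^sup>2 * (24 * a))" unfolding ab by simp
  finally have "(24 * s - r - 24 * S N) * b = (int p)\<^sup>2 * (24 * a)" by (simp only: of_int_eq_iff)
  then have "(int p)\<^sup>2 dvd (24 * s - r - 24 * S N) * b" by simp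
  moreover have "coprime ((int p)\<^sup>2) b" using ab(1) p by (simp add: prime_imp_coprime)
  ultimately have dv: "(int p)\<^sup>2 dvd 24 * s - r - 24 * S N"
    using coprime_dvd_mult_left_iff by blast
  define t where "t = int (d 0) + int (d 1) * int p"
  have "(int p)\<^sup>2 dvd S N - t"
    using N(1)
  proof (induction N rule: dec_induct)
    case base
    then show ?case by (simp add: S_def t_def eval_nat_numeral)
  next
    case (step n)
    have "(int p)\<^sup>2 dvd (S n - t) + int (d n) * int p ^ n"
      using step by (intro dvd_add dvd_mult le_imp_power_dvd) auto
    then show ?case by (simp add: S_def algebra_simps)
  qed
  \<comment> \<open>The added multiple of the square of \<open>p\<close> turns \<open>- r\<close>
    into \<open>24 * r * int g\<close>.\<close>
  then have "(int p)\<^sup>2 dvd 24 * s - r - 24 * S N + 24 * (S N - t) + (int p)\<^sup>2 * r"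
    using dv by (intro dvd_add dvd_mult[of _ _ 24]) auto
  also have "24 * s - r - 24 * S N + 24 * (S N - t) + (int p)\<^sup>2 * r = 24 * (s + r * int g - t)"
    unfolding gi by (simp add: algebra_simps)
  finally have "(int p)\<^sup>2 dvd 24 * (s + r * int g - t)" .
  moreover have "coprime ((int p)\<^sup>2) 24" using n24 p by (simp add: prime_imp_coprime)
  ultimately have "(int p)\<^sup>2 dvd s + r * int g - t" using coprime_dvd_mult_right_iff by blast
  then have eq: "(s + r * int g) mod (int p)\<^sup>2 = t mod (int p)\<^sup>2" by (simp add: mod_eq_dvd_iff)
  have dp: "d 0 < p" "d 1 < p" using d by (simp_all add: padic_expansion_def)
  have "t < (int p)\<^sup>2"
  proof -
    have "t < int p + int (d 1) * int p" using dp by (simp add: t_def)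
    also have "\<dots> = (int (d 1) + 1) * int p" by (simp add: algebra_simps)
    also have "\<dots> \<le> int p * int p" using dp by (intro mult_right_mono) auto
    finally show ?thesis by (simp add: power2_eq_square)
  qed
  moreover have "t \<ge> 0" by (simp add: t_def)
  ultimately have "(s + r * int g) mod (int p)\<^sup>2 = t" unfolding eq by (simp add: mod_pos_pos_trivial)
  moreover have "t div int p = int (d 1)" using dp by (simp add: t_def)
  ultimately show ?thesis using dig by (simp add: x_def)
qed

section \<open>Conclusion\<close>

lemma one_minus_q_powi_H_val_nth:
  assumes "n < N"
  shows "(pw s * H_val (pw r) N 0) $ n = - 2 * xi r s n"
proof -
  define A where "A = (\<Sum>i<N. fishburn_term r i)"
  have f: "fishburn_term r i = (\<Prod>j=1..i. 1 - pw r ^ j)" for i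
    by (simp add: fishburn_term_def one_minus_q_powi_power)
  have "A $ k = (\<Sum>i. fishburn_term r i) $ k" if "k \<le> n" for k
  proof -
    have "A $ k = (\<Sum>i\<le>k. fishburn_term r i $ k)"
      unfolding A_def fps_sum_nth using that assms
      by (intro sum.mono_neutral_right) (auto intro: fishburn_term_nth_eq_0)
    then show ?thesis by (simp add: sums_unique[OF fishburn_term_sums, symmetric])
  qed
  then have A: "(pw s * A) $ n = xi r s n"
    by (simp add: xi_def fps_mult_nth)
  have e: "pw s * H_val (pw r) N 0 = of_int (- 2) * (pw s * A)"
    unfolding H_val_0 A_def f by (simp add: mult.left_commute)
  show ?thesis unfolding e by (simp add: A fps_of_int[symmetric] mult.assoc)
qed

text \<open>With \<open>d\<close> the square of \<open>p\<close>, multiplying by this series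
  preserves the first two digits of an exponent.\<close>

lemma H_val_span:
  assumes "K = {k. d dvd k}" "d dvd a"
  shows "H_val (pw a) N 0 \<in> pw_span K"
proof -
  have "pw a ^ j \<in> pw_span K" for j
    using pw_span_base[of "a * int j" K 1] assms by (simp add: one_minus_q_powi_power)
  moreover have one: "1 \<in> pw_span K" using assms by (intro pw_span_one) simp
  ultimately have f: "1 - pw a ^ j \<in> pw_span K" for j by (intro pw_span_diff)
  have "(\<Prod>j=1..n. 1 - pw a ^ j) \<in> pw_span K" for n
  proof (induction n)
    case (Suc n)
    have "(\<Prod>j=1..n. 1 - pw a ^ j) * (1 - pw a ^ Suc n) \<in> pw_span K"
      using Suc f by (rule pw_span_mult) (use assms in auto)
    then show ?case by simp
  qed (use one in simp)
  then have "of_int (- 2) * (\<Sum>n<N. \<Prod>j=1..n. 1 - pw a ^ j) \<in> pw_span K"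
    by (intro pw_span_of_int pw_span_sum)
  then show ?thesis unfolding H_val_0 by simp
qed

lemma S_set_residue:
  assumes "p > 0" "chi12 n \<noteq> 0"
  shows "nat ((s + r * int ((n\<^sup>2 - 1) div 24)) mod int p) \<in> S_set p r s"
proof -
  obtain a where a: "int ((n\<^sup>2 - 1) div 24) = a * (3 * a - 1) div 2"
    using assms(2) by (rule chi12_nonzero_square)
  define k where "k = s + r * (a * (3 * a - 1) div 2)"
  have "nat (k mod int p) < p" using assms(1) by (simp add: nat_less_iff)
  moreover have "[k mod int p - s = k - s] (mod int p)" by (simp add: cong_def mod_diff_left_eq)
  then have "[int (nat (k mod int p)) - s = r * (a * (3 * a - 1) div 2)] (mod int p)"
    using assms(1) by (simp add: k_def)
  ultimately show ?thesis unfolding S_set_def a k_def by (auto intro: exI[of _ a])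
qed

lemma residue_bound:
  assumes "finite A" "nat (k mod int p) \<in> A" "j \<in> {1..p - 1 - Max A}" "p > 0"
  shows "k mod int p + int j < int p"
proof -
  have "nat (k mod int p) \<le> Max A" using assms by simp
  then have "k mod int p \<le> int (Max A)" by linarith
  then show ?thesis using assms by auto
qed

lemma finite_S_set: "finite (S_set p r s)"
  by (simp add: S_set_def)

lemma dvd_xi:
  fixes p :: nat
  assumes p: "prime p" and r: "\<not> int p dvd r" and j: "j \<in> {1..p - 1 - Max (S_set p r s)}"
    and m: "m \<ge> 1" and l: "l \<ge> 1"
  shows "int p ^ l dvd xi r s (p ^ l * m - j)"
proof -
  have p0: "p > 0" using p prime_gt_0_nat by blast
  \<comment> \<open>For \<open>p = 2\<close> the set contains 1, so no \<open>j\<close> is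
    admissible.\<close>
  have odd: "odd p"
  proof
    assume "even p"
    then have p2: "p = 2" using p primes_dvd_imp_eq two_is_prime_nat by blast
    then have "odd r" using r by simp
    then have "1 \<in> S_set p r s"
      unfolding S_set_def p2
      by (cases "even s") (auto simp: cong_iff_dvd_diff intro: exI[of _ 0] exI[of _ 1])
    then have "Max (S_set p r s) \<ge> 1" using finite_S_set by simp
    then show False using j p2 by simp
  qed
  define n where "n = p ^ l * m - j"
  \<comment> \<open>Working modulo \<open>fps_X ^ Suc n\<close> still determines coefficient
    \<open>n\<close>.\<close>
  define M where "M = Suc n"
  define G where "G = pw s * (\<Sum>J\<le>Suc M. of_nat (Suc M choose J) * weight p r J *
      theta_set (pw r) {..<6 * (p * J)})"
  have "fps_X ^ M dvd pw s * (weight_sum p r M * H_val (pw r) (Suc M) 0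
     - (\<Sum>J\<le>Suc M. of_nat (Suc M choose J) * weight p r J * theta_sum (pw r) (p * J)))"
    by (intro dvd_mult weight_sum_H_val odd)
  also have "\<dots> = weight_sum p r M * (pw s * H_val (pw r) (Suc M) 0) - G"
    unfolding G_def theta_set_def theta_sum_def by (simp only: right_diff_distrib mult.left_commute)
  finally have F: "fps_X ^ M dvd weight_sum p r M * (pw s * H_val (pw r) (Suc M) 0) - G" .
  have G: "G \<in> pw_span {k. k mod int p + int j < int p}"
    unfolding G_def
    using residue_bound[OF finite_S_set S_set_residue[OF p0] j p0]
    by (intro weighted_theta_span)
  have "int p ^ l dvd (pw s * H_val (pw r) (Suc M) 0) $ n"
    unfolding n_def
    by (rule pw_span_cancel[OF p odd weight_sum_span weight_sum_nth_0 G F])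
      (use j m l in \<open>auto simp: M_def n_def\<close>)
  then have "int p ^ l dvd 2 * xi r s n"
    by (subst (asm) one_minus_q_powi_H_val_nth) (auto simp: M_def)
  moreover have "coprime (int p ^ l) 2" using odd by simp
  ultimately show ?thesis unfolding n_def using coprime_dvd_mult_right_iff by blast
qed

lemma dvd_xi_digit:
  fixes p :: nat
  assumes p: "prime p" and r: "\<not> int p dvd r" and p5: "p \<ge> 5"
    and digit: "padic_digit p (of_int s - of_int r / 24) 1 \<noteq> p - 1"
    and i: "[24 * (int i - s) = - r] (mod int p)"
    and j: "j \<in> {1..p - 1 - Max (S_set p r s - {i})}"
    and m: "m \<ge> 1" and l: "l \<ge> 1"
  shows "int p ^ l dvd xi r s (p ^ l * m - j)"
proof -
  have p0: "p > 0" using p5 by simp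
  have odd: "odd p" using p p5 primes_dvd_imp_eq[of 2 p] by auto
  have chip: "chi12 p \<noteq> 0" using p p5 by (rule chi12_prime)
  define g where "g = (p\<^sup>2 - 1) div 24"
  have g: "p\<^sup>2 = 24 * g + 1" unfolding g_def using chip by (rule chi12_nonzero_square)
  define n where "n = p ^ l * m - j"
  define M where "M = Suc n"
  define u where "u = weight_sum p r M"
  define H where "H = H_val (pw r) (Suc M) 0"
  define H' where "H' = H_val (pw (r * (int p)\<^sup>2)) (Suc M) 0"
  define c where "c = int p * chi12 p"
  define b where "b J = of_nat (Suc M choose J) * weight p r J" for J
  define A where "A J = {n. n < 6 * (p * J) \<and> \<not> p dvd n}" for J
  define P where "P = pw r ^ g"
  \<comment> \<open>Removing the contribution of the multiples of \<open>p\<close> leaves a series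
    whose theta exponents avoid the class of \<open>i\<close>.\<close>
  define F where "F = pw s * H - of_int c * (pw s * P * H')"
  define G where "G = pw s * (\<Sum>J\<le>Suc M. b J * theta_set (pw r) (A J))"
  have Qp: "pw r ^ p\<^sup>2 = pw (r * (int p)\<^sup>2)" by (simp add: one_minus_q_powi_power)
  have 1: "fps_X ^ M dvd u * H - (\<Sum>J\<le>Suc M. b J * theta_sum (pw r) (p * J))"
    unfolding u_def H_def b_def by (rule weight_sum_H_val[OF odd])
  have 2: "fps_X ^ M dvd u * H' - (\<Sum>J\<le>Suc M. b J * theta_sum (pw (r * (int p)\<^sup>2)) J)"
    unfolding u_def H'_def b_def by (rule weight_sum_H_val_square[OF odd])
  have split: "(\<Sum>J\<le>Suc M. b J * theta_sum (pw r) (p * J)) =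
      (\<Sum>J\<le>Suc M. b J * theta_set (pw r) (A J))
      + of_int c * P * (\<Sum>J\<le>Suc M. b J * theta_sum (pw (r * (int p)\<^sup>2)) J)"
    unfolding theta_sum_split[OF p0 chip] g_def[symmetric] c_def[symmetric] Qp
      A_def[symmetric] P_def[symmetric] sum_distrib_left sum.distrib[symmetric]
    by (intro sum.cong refl) (simp only: distrib_left ac_simps)
  have "fps_X ^ M dvd pw s * (u * H - (\<Sum>J\<le>Suc M. b J * theta_sum (pw r) (p * J)))
      - pw s * of_int c * P * (u * H' - (\<Sum>J\<le>Suc M. b J * theta_sum (pw (r * (int p)\<^sup>2)) J))"
    by (intro dvd_diff dvd_mult[OF 1] dvd_mult[OF 2])
  also have "\<dots> = u * F - G"
    unfolding split F_def G_def by (simp only: algebra_simps)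
  finally have uF: "fps_X ^ M dvd u * F - G" .
  have res: "(s + r * int ((n\<^sup>2 - 1) div 24)) mod int p + int j < int p"
    if n: "n \<in> A J" "chi12 n \<noteq> 0" for n J
  proof (rule residue_bound[OF _ _ j p0])
    define h where "h = (n\<^sup>2 - 1) div 24"
    have h: "n\<^sup>2 = 24 * h + 1" unfolding h_def using n(2) by (rule chi12_nonzero_square)
    have hi: "24 * int h = (int n)\<^sup>2 - 1" using arg_cong[OF h, of int] by simp
    \<comment> \<open>The class of \<open>i\<close> would make \<open>p\<close> divide
      \<open>r * (int n)\<^sup>2\<close>, contrary to \<open>r\<close> and the choice of
      \<open>n\<close>.\<close>
    have "nat ((s + r * int h) mod int p) \<noteq> i"
    proof
      assume "nat ((s + r * int h) mod int p) = i"
      then have "int i = (s + r * int h) mod int p" using p0 by auto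
      then have "[int i = s + r * int h] (mod int p)" by (simp add: cong_def)
      then have "[24 * (int i - s) = 24 * (s + r * int h - s)] (mod int p)"
        by (intro cong_scalar_left cong_diff cong_refl)
      then have "[24 * (s + r * int h - s) = - r] (mod int p)"
        using i by (meson cong_sym cong_trans)
      then have "int p dvd 24 * (s + r * int h - s) - (- r)" by (simp only: cong_iff_dvd_diff)
      also have "24 * (s + r * int h - s) - (- r) = r * (24 * int h + 1)" by (simp add: algebra_simps)
      also have "\<dots> = r * (int n)\<^sup>2" unfolding hi by simp
      finally have "int p dvd r \<or> int p dvd int n"
        using p by (metis prime_dvd_mult_iff prime_dvd_power prime_nat_int_transfer)
      then show False using r n(1) by (simp add: A_def)
    qed
    then show "nat ((s + r * int ((n\<^sup>2 - 1) div 24)) mod int p) \<in> S_set p r s - {i}"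
      using S_set_residue[OF p0 n(2)] by (simp add: h_def)
  qed (simp add: finite_S_set)
  have G: "G \<in> pw_span {k. k mod int p + int j < int p}"
    unfolding G_def b_def using res by (intro weighted_theta_span)
  have jp: "1 \<le> j" "j < p" using j p0 by auto
  have Fn: "int p ^ l dvd F $ n"
    unfolding n_def
    by (rule pw_span_cancel[OF p odd weight_sum_span weight_sum_nth_0 G uF[unfolded u_def]])
      (use jp m l in \<open>auto simp: M_def n_def\<close>)
  define k0 where "k0 = s + r * int g"
  have sP: "pw s * P = pw k0"
    by (simp add: P_def k0_def one_minus_q_powi_power one_minus_q_powi_add)
  have span: "of_int 1 * pw k0 * H' \<in> pw_span {k. k mod (int p)\<^sup>2 = k0 mod (int p)\<^sup>2}"
  proof (rule pw_span_mult)
    show "of_int 1 * pw k0 \<in> pw_span {k0}" by (rule pw_span_base) simp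
    show "H' \<in> pw_span {k. (int p)\<^sup>2 dvd k}"
      unfolding H'_def by (rule H_val_span[OF refl]) simp
  qed (auto simp: dvd_def)
  have dig: "(k0 mod (int p)\<^sup>2) div int p \<noteq> int p - 1"
    using padic_digit_one[OF p g, of s r] digit p0 unfolding k0_def by (auto simp: of_nat_diff)
  \<comment> \<open>By the digit condition at most one factor \<open>p\<close> is lost here; the
    factor \<open>p\<close> in \<open>c\<close> restores it.\<close>
  have "int p ^ (l - 1) dvd (of_int 1 * pw k0 * H') $ n"
    unfolding n_def
    by (rule pw_span_nth_dvd[OF span]) (use one_minus_q_powi_nth_dvd(2)[OF p m l jp] dig in auto)
  then have "int p * int p ^ (l - 1) dvd c * (pw k0 * H') $ n"
    unfolding c_def by (simp add: mult.assoc)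
  then have c: "int p ^ l dvd c * (pw k0 * H') $ n" using l by (simp flip: power_Suc)
  have "F $ n = (pw s * H) $ n - c * (pw k0 * H') $ n"
    unfolding F_def sP by (simp add: fps_of_int[symmetric])
  then have "F $ n = - 2 * xi r s n - c * (pw k0 * H') $ n"
    unfolding H_def by (subst (asm) one_minus_q_powi_H_val_nth) (simp_all add: M_def)
  then have "- 2 * xi r s n = F $ n + c * (pw k0 * H') $ n" by simp
  then have "int p ^ l dvd - 2 * xi r s n" using Fn c by (simp only: dvd_add)
  then have "int p ^ l dvd 2 * xi r s n" by simp
  moreover have "coprime (int p ^ l) 2" using odd by simp
  ultimately show ?thesis unfolding n_def using coprime_dvd_mult_right_iff by blast
qed

theorem theorem4:
  fixes p :: nat and r s :: int
  assumes "prime p" and "\<not> int p dvd r"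
  shows "(\<forall>j \<in> {1..p - 1 - Max (S_set p r s)}. \<forall>m \<ge> 1. \<forall>l \<ge> 1.
            [xi r s (p ^ l * m - j) = 0] (mod int p ^ l)) \<and>
         (p \<ge> 5 \<and> padic_digit p (of_int s - of_int r / 24) 1 \<noteq> p - 1 \<longrightarrow>
           (\<forall>i\<^sub>0 \<in> {0..p - 1}. [24 * (int i\<^sub>0 - s) = - r] (mod int p) \<longrightarrow>
             (\<forall>j \<in> {1..p - 1 - Max (S_set p r s - {i\<^sub>0})}. \<forall>m \<ge> 1. \<forall>l \<ge> 1.
                [xi r s (p ^ l * m - j) = 0] (mod int p ^ l))))"
  using dvd_xi[OF assms] dvd_xi_digit[OF assms] by (simp add: cong_0_iff)

end
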